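(* Let $f:[0,1]\to[0,1]$ be continuous. Then CO-measures are dense in the set of all ergodic $f$-invariant measures; that is, every ergodic $f$-invariant Borel probability measure is a weak limit of CO-measures.
   Context: A CO-measure is an $f$-invariant Borel probability measure whose support is a single periodic orbit. The set of $f$-invariant Borel probability measures on $[0,1]$ carries the weak topology. *)

theory Defs
  imports "HOL-Probability.Probability"
begin

text \<open>
  Maps of the unit interval are functions on the reals, used only on \<open>{0..1}\<close>; measures on the unit
  interval have the Borel \<open>\<sigma>\<close>-algebra of the subspace \<open>{0..1}\<close>, so their space is \<open>{0..1}\<close>.
\<close>

abbreviation unit_borel :: "real measure" where
  "unit_borel \<equiv> restrict_space borel {0..1}"

definition invariant_measures :: "(real \<Rightarrow> real) \<Rightarrow> real measure set" where
  "invariant_measures f =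
     {M. sets M = sets unit_borel \<and> prob_space M \<and>
         (\<forall>A\<in>sets M. emeasure M (f -` A \<inter> space M) = emeasure M A)}"

definition ergodic_measures :: "(real \<Rightarrow> real) \<Rightarrow> real measure set" where
  "ergodic_measures f =
     {M \<in> invariant_measures f.
        \<forall>A\<in>sets M. f -` A \<inter> space M = A \<longrightarrow> emeasure M A = 0 \<or> emeasure M A = 1}"

text \<open>The sets \<open>U \<inter> space M\<close> with \<open>U\<close> open are the relatively open subsets of the space.\<close>

definition measure_support :: "real measure \<Rightarrow> real set" where
  "measure_support M = {x \<in> space M. \<forall>U. open U \<and> x \<in> U \<longrightarrow> emeasure M (U \<inter> space M) > 0}"

definition periodic_orbit :: "(real \<Rightarrow> real) \<Rightarrow> real set \<Rightarrow> bool" where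
  "periodic_orbit f P \<longleftrightarrow>
     (\<exists>x\<in>{0..1}. \<exists>n>0. (f ^^ n) x = x \<and> P = range (\<lambda>k. (f ^^ k) x))"

definition CO_measures :: "(real \<Rightarrow> real) \<Rightarrow> real measure set" where
  "CO_measures f = {M \<in> invariant_measures f. periodic_orbit f (measure_support M)}"

text \<open>
  The weak topology: the coarsest topology on the set of invariant measures that makes
  \<open>M \<mapsto> \<integral>x. \<phi> x \<partial>M\<close> continuous for every continuous real function \<open>\<phi>\<close> on \<open>[0,1]\<close>.
\<close>

definition weak_topology :: "(real \<Rightarrow> real) \<Rightarrow> real measure topology" where
  "weak_topology f =
     topology_generated_by
       {{M \<in> invariant_measures f. (\<integral>x. \<phi> x \<partial>M) \<in> U} | (\<phi> :: real \<Rightarrow> real) U.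
          continuous_on {0..1} \<phi> \<and> open U}"

lemma openin_weak_topology_basic:
  fixes \<phi> :: "real \<Rightarrow> real"
  assumes "continuous_on {0..1} \<phi>" and "open U"
  shows "openin (weak_topology f) {M \<in> invariant_measures f. (\<integral>x. \<phi> x \<partial>M) \<in> U}"
  unfolding weak_topology_def
  by (rule topology_generated_by_Basis) (rule CollectI, rule exI[of _ \<phi>], rule exI[of _ U], intro conjI refl assms)

lemma topspace_weak_topology [simp]: "topspace (weak_topology f) = invariant_measures f"
proof
  show "topspace (weak_topology f) \<subseteq> invariant_measures f"
    unfolding weak_topology_def topology_generated_by_topspace by auto
  show "invariant_measures f \<subseteq> topspace (weak_topology f)"
    using openin_subset[OF openin_weak_topology_basic[of "\<lambda>_. 0" UNIV f]] by simp
qed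

lemma limitin_weak_topology:
  "limitin (weak_topology f) N M F \<longleftrightarrow>
     M \<in> invariant_measures f \<and> (\<forall>\<^sub>F i in F. N i \<in> invariant_measures f) \<and>
     (\<forall>\<phi> :: real \<Rightarrow> real. continuous_on {0..1} \<phi> \<longrightarrow> ((\<lambda>i. \<integral>x. \<phi> x \<partial>N i) \<longlongrightarrow> (\<integral>x. \<phi> x \<partial>M)) F)"
  (is "?L \<longleftrightarrow> ?R")
proof
  assume L: ?L
  then have M: "M \<in> invariant_measures f" and N: "\<forall>\<^sub>F i in F. N i \<in> invariant_measures f"
    using limitin_topspace[OF L] limitinD[OF L openin_topspace] by auto
  have "((\<lambda>i. \<integral>x. \<phi> x \<partial>N i) \<longlongrightarrow> (\<integral>x. \<phi> x \<partial>M)) F" if \<phi>: "continuous_on {0..1} \<phi>" for \<phi> :: "real \<Rightarrow> real"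
  proof (rule topological_tendstoI)
    fix U :: "real set" assume U: "open U" "(\<integral>x. \<phi> x \<partial>M) \<in> U"
    from limitinD[OF L openin_weak_topology_basic[OF \<phi> U(1)]] M U have "\<forall>\<^sub>F i in F. N i \<in> {M \<in> invariant_measures f. (\<integral>x. \<phi> x \<partial>M) \<in> U}"
      by simp
    then show "\<forall>\<^sub>F i in F. (\<integral>x. \<phi> x \<partial>N i) \<in> U"
      by (rule eventually_mono) simp
  qed
  with M N show ?R by blast
next
  assume R: ?R
  have "\<forall>\<^sub>F i in F. N i \<in> W" if "openin (weak_topology f) W" "M \<in> W" for W
    using that unfolding weak_topology_def openin_topology_generated_by_iff
  proof (induction rule: generate_topology_on.induct)
    case Empty
    then show ?case by simp
  next
    case (Int a b)
    then show ?case by (auto intro: eventually_conj)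
  next
    case (UN K)
    then obtain k where k: "k \<in> K" "M \<in> k" by blast
    from UN.IH[OF this] show ?case
      by (rule eventually_mono) (use k in blast)
  next
    case (Basis s)
    then obtain \<phi> :: "real \<Rightarrow> real" and U where *: "continuous_on {0..1} \<phi>" "open U"
      "s = {M \<in> invariant_measures f. (\<integral>x. \<phi> x \<partial>M) \<in> U}" by blast
    with Basis.prems have "(\<integral>x. \<phi> x \<partial>M) \<in> U" by simp
    then have "\<forall>\<^sub>F i in F. (\<integral>x. \<phi> x \<partial>N i) \<in> U"
      using R *(1,2) topological_tendstoD by metis
    moreover have "\<forall>\<^sub>F i in F. N i \<in> invariant_measures f" using R by blast
    ultimately show ?case unfolding *(3) by (simp add: eventually_conj_iff)
  qed
  with R show ?L unfolding limitin_def by simp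
qed

end

theory Submission
  imports Defs
begin

text \<open>
  An atomic ergodic measure is a CO-measure. Otherwise its distribution function \<open>h\<close> is continuous;
  take \<open>x\<close> in the support whose orbit is equidistributed (Birkhoff), and measure distances by \<open>h\<close>, so
  that an interval has positive length iff it has positive measure. Let \<open>B\<^sub>n(y)\<close> be the component of \<open>y\<close> in
  its Bowen ball of radius \<open>e\<close> and length \<open>n\<close> (a \<open>tube\<close> below), an interval.

  If the orbit of some \<open>y = f\<^sup>k(x)\<close> returns to \<open>B\<^sub>\<infinity>(y)\<close> after \<open>n\<close> steps, then either \<open>f\<^sup>n\<close> has a fixed point in
  some \<open>f\<^sup>n\<^sup>j(B\<^sub>\<infinity>(y))\<close>, which shadows the orbit of \<open>x\<close> forever, or \<open>f\<^sup>n\<^sup>j(y)\<close> is monotone in \<open>j\<close> and hence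
  converges, contradicting equidistribution. If there is no such return, \<open>B\<^sub>n(y)\<close> shrinks to a set of
  \<open>h\<close>-length zero for every \<open>y\<close> in the orbit. Whenever \<open>B\<^sub>n(x)\<close> shrinks, \<open>f\<^sup>n(B\<^sub>n(x))\<close> has \<open>h\<close>-length at least \<open>e\<close>,
  so by pigeonhole one open set \<open>V\<close> of positive measure lies in \<open>f\<^sup>n(B\<^sub>n(x))\<close> for infinitely many \<open>n\<close>. If
  \<open>f\<^sup>k(x) \<in> V\<close>, then \<open>f\<^sup>n\<^sup>-\<^sup>k(B\<^sub>n\<^sub>-\<^sub>k(f\<^sup>k(x))) \<supseteq> V \<supseteq> B\<^sub>n\<^sub>-\<^sub>k(f\<^sup>k(x))\<close> for such large \<open>n\<close>, and the intermediate
  value theorem gives a periodic point whose orbit \<open>h\<close>-shadows that of \<open>x\<close> up to \<open>e\<close> for a full period.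
\<close>

section \<open>Interval maps with an equidistributed orbit\<close>

lemma pos_if_no_zero:
  fixes F :: "real \<Rightarrow> real"
  assumes "connected S" "continuous_on S F" "\<And>u. u \<in> S \<Longrightarrow> F u \<noteq> 0" "a \<in> S" "F a > 0" "u \<in> S"
  shows "F u > 0"
proof (rule ccontr)
  assume "\<not> F u > 0"
  moreover have "connected (F ` S)" using assms by (intro connected_continuous_image)
  ultimately have "0 \<in> F ` S"
    using connectedD_interval[of "F ` S" "F u" "F a" 0] assms by auto
  then show False using assms(3) by auto
qed

text \<open>At preimages in \<open>S\<close> of its minimum and maximum, \<open>F u - u\<close> is
  \<open>\<le> 0\<close> and \<open>\<ge> 0\<close> respectively; the intermediate value theorem
  gives a zero.\<close>

lemma fixed_point_of_covering:
  fixes F :: "real \<Rightarrow> real"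
  assumes "compact S" "connected S" "S \<noteq> {}" "continuous_on S F" "S \<subseteq> F ` S"
  shows "\<exists>z\<in>S. F z = z"
proof -
  obtain a b where "a \<in> S" "b \<in> S" and ab: "\<And>u. u \<in> S \<Longrightarrow> a \<le> u \<and> u \<le> b"
    using compact_attains_inf[OF assms(1,3)] compact_attains_sup[OF assms(1,3)] by metis
  with assms(5) obtain u v where uv: "u \<in> S" "F u = a" "v \<in> S" "F v = b" by (metis imageE subsetD)
  have "connected ((\<lambda>u. F u - u) ` S)"
    using assms by (intro connected_continuous_image continuous_intros)
  moreover have "F u - u \<le> 0" "0 \<le> F v - v" using uv ab by auto
  ultimately have "0 \<in> (\<lambda>u. F u - u) ` S"
    using uv connectedD_interval[of "(\<lambda>u. F u - u) ` S" "F u - u" "F v - v" 0] by auto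
  then show ?thesis by auto
qed

text \<open>An interval longer than \<open>e\<close> contains a full cell of the grid of mesh
  \<open>e/2\<close>, and only finitely many cells are available in the unit interval, so one cell
  serves infinitely many \<open>n\<close>.\<close>

lemma infinite_common_band:
  fixes e :: real and l r :: "nat \<Rightarrow> real"
  assumes "e > 0" "\<And>N. \<exists>n\<ge>N. 0 \<le> l n \<and> r n \<le> 1 \<and> l n + e < r n"
  shows "\<exists>a b. 0 \<le> a \<and> a < b \<and> b \<le> 1 \<and> infinite {n. l n \<le> a \<and> b \<le> r n}"
proof -
  define A where "A = {n. 0 \<le> l n \<and> r n \<le> 1 \<and> l n + e < r n}"
  have "infinite A"
    using assms(2) unfolding infinite_nat_iff_unbounded_le by (auto simp: A_def)
  moreover have "\<forall>n\<in>A. \<exists>j\<in>{..nat \<lceil>2 / e\<rceil>}. l n \<le> real j * (e/2) \<and> (real j + 1) * (e/2) \<le> r n"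
  proof
    fix n assume "n \<in> A"
    then have n: "0 \<le> l n" "r n \<le> 1" "l n + e < r n" by (auto simp: A_def)
    define j where "j = nat \<lceil>l n / (e/2)\<rceil>"
    have "0 \<le> l n / (e/2)" using n assms by simp
    then have "l n / (e/2) \<le> real j" "real j < l n / (e/2) + 1"
      unfolding j_def by linarith+
    then have j: "l n \<le> real j * (e/2)" "real j * (e/2) < l n + e/2"
      using assms(1) by (auto simp: field_simps)
    then have "real j * (e/2) \<le> 1" using n assms(1) by linarith
    then have "real j \<le> 2 / e" using assms(1) by (simp add: field_simps)
    then have "j \<le> nat \<lceil>2 / e\<rceil>" by linarith
    moreover have "(real j + 1) * (e/2) \<le> r n" using j n by (simp add: algebra_simps)
    ultimately show "\<exists>j\<in>{..nat \<lceil>2 / e\<rceil>}. l n \<le> real j * (e/2) \<and> (real j + 1) * (e/2) \<le> r n"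
      using j by blast
  qed
  ultimately obtain j where j: "infinite {n\<in>A. l n \<le> real j * (e/2) \<and> (real j + 1) * (e/2) \<le> r n}"
    using pigeonhole_infinite_rel[of A "{..nat \<lceil>2 / e\<rceil>}"
        "\<lambda>n j. l n \<le> real j * (e/2) \<and> (real j + 1) * (e/2) \<le> r n"] by auto
  then obtain n where "n \<in> A" "(real j + 1) * (e/2) \<le> r n"
    by (metis (mono_tags, lifting) finite.emptyI all_not_in_conv mem_Collect_eq)
  then have "(real j + 1) * (e/2) \<le> 1" by (auto simp: A_def)
  moreover have "infinite {n. l n \<le> real j * (e/2) \<and> (real j + 1) * (e/2) \<le> r n}"
    using j by (rule infinite_super[rotated]) auto
  ultimately show ?thesis
    using assms(1)
    by (intro exI[of _ "real j * (e/2)"] exI[of _ "(real j + 1) * (e/2)"]) auto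
qed

section \<open>Equidistributed orbits and their empirical distribution functions\<close>

definition orbit_cdf :: "('a \<Rightarrow> 'a) \<Rightarrow> nat \<Rightarrow> 'a \<Rightarrow> 'a :: ord \<Rightarrow> real" where
  "orbit_cdf f n x t = card {i. i < n \<and> (f ^^ i) x \<le> t} / n"

definition generic :: "(real \<Rightarrow> real) \<Rightarrow> (real \<Rightarrow> real) \<Rightarrow> real \<Rightarrow> bool" where
  "generic f h x \<longleftrightarrow> (\<forall>t. (\<lambda>n. orbit_cdf f n x t) \<longlonglongrightarrow> h t)"

lemma genericD: "generic f h x \<Longrightarrow> (\<lambda>n. orbit_cdf f n x t) \<longlonglongrightarrow> h t"
  by (simp add: generic_def)

lemma orbit_cdf_mono:
  fixes s t :: "'a :: order"
  shows "s \<le> t \<Longrightarrow> orbit_cdf f n x s \<le> orbit_cdf f n x t"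
  unfolding orbit_cdf_def
  by (intro divide_right_mono of_nat_mono card_mono) auto

lemma orbit_cdf_bounds: "0 \<le> orbit_cdf f n x t" "orbit_cdf f n x t \<le> 1"
proof -
  have "card {i. i < n \<and> (f ^^ i) x \<le> t} \<le> card {..<n}" by (intro card_mono) auto
  then show "orbit_cdf f n x t \<le> 1" by (auto simp: orbit_cdf_def divide_simps)
qed (simp add: orbit_cdf_def)

lemma generic_step:
  assumes "generic f h x"
  shows "generic f h (f x)"
  unfolding generic_def
proof
  fix t
  define c where "c = real (card {i. i < (1::nat) \<and> (f ^^ i) x \<le> t})"
  \<comment> \<open>\<open>c\<close> counts the point \<open>x\<close> itself, which the orbit of
    \<open>f x\<close> omits. At \<open>n = 0\<close> both sides are 0 because division by zero
    yields 0.\<close>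
  have eq: "orbit_cdf f n (f x) t = orbit_cdf f (Suc n) x t * (real (Suc n) / n) - c / n" for n
  proof -
    have "{i. i < Suc n \<and> (f ^^ i) x \<le> t} =
            {i. i < (1::nat) \<and> (f ^^ i) x \<le> t} \<union> Suc ` {i. i < n \<and> (f ^^ i) (f x) \<le> t}"
      (is "?A = ?B \<union> ?C")
      by (auto simp: image_iff funpow_swap1 less_Suc_eq_0_disj)
    moreover have "card (?B \<union> ?C) = card ?B + card ?C" by (intro card_Un_disjoint) auto
    ultimately have "card ?A = card ?B + card {i. i < n \<and> (f ^^ i) (f x) \<le> t}"
      by (simp add: card_image)
    then have "card {i. i < n \<and> (f ^^ i) (f x) \<le> t} = orbit_cdf f (Suc n) x t * real (Suc n) - c"
      by (simp add: orbit_cdf_def c_def del: of_nat_Suc)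
    then show ?thesis unfolding orbit_cdf_def[of f n] by (simp add: diff_divide_distrib)
  qed
  have "(\<lambda>n. orbit_cdf f (Suc n) x t * (real (Suc n) / n) - c / n) \<longlonglongrightarrow> h t * 1 - 0"
    by (intro tendsto_intros LIMSEQ_Suc_n_over_n lim_const_over_n
        LIMSEQ_Suc[OF genericD[OF assms]])
  then show "(\<lambda>n. orbit_cdf f n (f x) t) \<longlonglongrightarrow> h t" by (simp add: eq[abs_def])
qed

lemma generic_funpow: "generic f h x \<Longrightarrow> generic f h ((f ^^ k) x)"
  by (induction k) (auto intro: generic_step)

lemma generic_mono:
  assumes "generic f h x"
  shows "mono h"
proof (rule monoI)
  fix s t :: real assume "s \<le> t"
  then show "h s \<le> h t"
    by (intro LIMSEQ_le[OF genericD[OF assms] genericD[OF assms]] exI allI impI orbit_cdf_mono)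
qed


text \<open>If the orbit avoided an interval, its empirical distribution functions would agree at
  both ends, hence so would \<open>h\<close>. Starting from the generic point
  \<open>(f ^^ k) x\<close> makes the visit late.\<close>

lemma generic_visits:
  assumes "generic f h x" "continuous_on UNIV h" "h a < h b"
  shows "\<exists>i\<ge>k. h a < h ((f ^^ i) x) \<and> h ((f ^^ i) x) < h b"
proof -
  define y where "y = (f ^^ k) x"
  have g: "generic f h y" using generic_funpow[OF assms(1)] by (simp add: y_def)
  note mono = generic_mono[OF assms(1)]
  have "a \<le> b" using assms(3) monoD[OF mono, of b a] by linarith
  have ivt: "\<exists>u. h u = s" if "h a < s" "s < h b" for s
    using IVT'[of h a s b] that \<open>a \<le> b\<close> continuous_on_subset[OF assms(2)] by auto
  \<comment> \<open>The thirds leave room: a visit to \<open>(p, q]\<close> gives only weak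
    inequalities between values of \<open>h\<close>, and these must stay strictly between
    \<open>h a\<close> and \<open>h b\<close>.\<close>
  obtain p where p: "h p = (2 * h a + h b) / 3" using ivt[of "(2 * h a + h b) / 3"] assms(3) by auto
  obtain q where q: "h q = (h a + 2 * h b) / 3" using ivt[of "(h a + 2 * h b) / 3"] assms(3) by auto
  have "\<exists>i. p < (f ^^ i) y \<and> (f ^^ i) y \<le> q"
  proof (rule ccontr)
    assume "\<not> ?thesis"
    then have "orbit_cdf f n y q \<le> orbit_cdf f n y p" for n
      unfolding orbit_cdf_def by (intro divide_right_mono of_nat_mono card_mono) (auto simp: not_le not_less)
    then have "h q \<le> h p"
      by (intro LIMSEQ_le[OF genericD[OF g] genericD[OF g]] exI allI impI)
    with p q assms show False by simp
  qed
  then obtain i where "p < (f ^^ i) y" "(f ^^ i) y \<le> q" by auto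
  then have "h p \<le> h ((f ^^ i) y)" "h ((f ^^ i) y) \<le> h q" by (auto intro: monoD[OF mono])
  with p q assms show ?thesis by (intro exI[of _ "i + k"]) (auto simp: y_def funpow_add)
qed

lemma generic_ex_value:
  assumes "generic f h x" "continuous_on UNIV h" "h 0 = 0" "h 1 = 1" "0 \<le> s" "s \<le> 1"
  shows "\<exists>u. h u = s"
  using IVT'[of h 0 s 1] assms continuous_on_subset[OF assms(2)] by auto

text \<open>Polya's argument: monotone functions converging pointwise to a continuous distribution
  function converge uniformly, since finitely many levels of \<open>h\<close> control everything in
  between.\<close>

lemma generic_uniform:
  assumes "generic f h x" "continuous_on UNIV h" "h 0 = 0" "h 1 = 1" "e > 0"
  shows "\<forall>\<^sub>F n in sequentially. \<forall>t. \<bar>orbit_cdf f n x t - h t\<bar> \<le> e"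
proof -
  note mono = generic_mono[OF assms(1)]
  obtain n where "inverse (real (Suc n)) < e / 4"
    using reals_Archimedean[of "e / 4"] assms(5) by auto
  then obtain M :: nat where M: "M > 0" "1 / M < e / 4"
    by (metis inverse_eq_divide zero_less_Suc)
  define d where "d = 1 / real M"
  have d: "d > 0" "d < e / 4" "d * M = 1" using M by (auto simp: d_def)
  have "\<exists>u. h u = j * d" if "j \<le> M" for j :: nat
    using that d(1) M by (intro generic_ex_value[OF assms(1-4)]) (auto simp: d_def)
  then obtain \<tau> where \<tau>: "\<And>j. j \<le> M \<Longrightarrow> h (\<tau> j) = real j * d" by metis
  have "\<forall>\<^sub>F n in sequentially. \<forall>j\<in>{..M}. \<bar>orbit_cdf f n x (\<tau> j) - h (\<tau> j)\<bar> < e / 2"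
    using assms(5) tendstoD[OF genericD[OF assms(1)], of "e/2"]
    by (intro eventually_ball_finite) (auto simp: dist_real_def)
  then show ?thesis
  proof eventually_elim
    case (elim n)
    show ?case
    proof
      fix t
      have ht: "0 \<le> h t" "h t \<le> 1"
        by (intro LIMSEQ_le_const[OF genericD[OF assms(1)]] LIMSEQ_le_const2[OF genericD[OF assms(1)]]
              exI allI impI orbit_cdf_bounds)+
      define j where "j = nat \<lfloor>h t / d\<rfloor>"
      have "0 \<le> h t / d" using ht d by simp
      then have "real j \<le> h t / d" "h t / d < real j + 1"
        unfolding j_def by linarith+
      then have j: "real j * d \<le> h t" "h t < (real j + 1) * d" using d(1) by (auto simp: field_simps)
      have up: "orbit_cdf f n x t \<le> h t + e"
      proof (cases "j + 1 \<le> M")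
        case True
        have "h t < h (\<tau> (j + 1))" using \<tau>[OF True] j by (simp add: add.commute)
        then have "t \<le> \<tau> (j + 1)" using monoD[OF mono, of "\<tau> (j + 1)" t] by linarith
        then have "orbit_cdf f n x t \<le> orbit_cdf f n x (\<tau> (j + 1))" by (rule orbit_cdf_mono)
        also have "\<dots> \<le> h (\<tau> (j + 1)) + e / 2" using bspec[OF elim, of "j + 1"] True unfolding atMost_iff by linarith
        also have "\<dots> \<le> h t + e" using \<tau>[OF True] j d by (simp add: algebra_simps)
        finally show ?thesis .
      next
        case False
        then have "real M * d \<le> real j * d" using d(1) by (intro mult_right_mono) auto
        then have "1 \<le> h t" using j d by (simp add: mult.commute)
        with orbit_cdf_bounds(2)[of f n x t] assms(5) show ?thesis by linarith
      qed
      \<comment> \<open>The comparison uses level \<open>j - 1\<close> rather than \<open>j\<close>: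
        if \<open>h t = j * d\<close>, a flat piece of \<open>h\<close> allows
        \<open>\<tau> j > t\<close>.\<close>
      have lo: "h t - e \<le> orbit_cdf f n x t"
      proof (cases "j = 0")
        case True
        then show ?thesis using j d orbit_cdf_bounds(1)[of f n x t] by simp
      next
        case False
        have "real j * d \<le> real M * d" using j ht d by (simp add: mult.commute)
        then have jM: "j - 1 \<le> M" using d(1) by simp
        have h: "h (\<tau> (j - 1)) = (real j - 1) * d" using \<tau>[OF jM] False by (simp add: of_nat_diff)
        then have "h (\<tau> (j - 1)) < h t" using j d by (simp add: algebra_simps)
        then have "\<tau> (j - 1) \<le> t" using monoD[OF mono, of t "\<tau> (j - 1)"] by linarith
        then have "orbit_cdf f n x (\<tau> (j - 1)) \<le> orbit_cdf f n x t" by (rule orbit_cdf_mono)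
        moreover have "h (\<tau> (j - 1)) - e / 2 \<le> orbit_cdf f n x (\<tau> (j - 1))"
          using bspec[OF elim, of "j - 1"] jM unfolding atMost_iff by linarith
        moreover have "h t - e \<le> h (\<tau> (j - 1)) - e / 2 + (2 * d - e / 2)" using h j by (simp add: algebra_simps)
        ultimately show ?thesis using d by linarith
      qed
      show "\<bar>orbit_cdf f n x t - h t\<bar> \<le> e" using up lo by linarith
    qed
  qed
qed

section \<open>Tubes in the interval and the periodic points they contain\<close>

locale interval_map =
  fixes f :: "real \<Rightarrow> real"
  assumes cont: "continuous_on {0..1} f" and maps: "f \<in> {0..1} \<rightarrow> {0..1}"
begin

lemma funpow_mem: "x \<in> {0..1} \<Longrightarrow> (f ^^ n) x \<in> {0..1}"
  using maps by (induction n) auto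

lemma continuous_on_funpow: "continuous_on {0..1} (f ^^ n)"
proof (induction n)
  case (Suc n)
  have "(f ^^ n) ` {0..1} \<subseteq> {0..1}" using funpow_mem by blast
  then have "continuous_on {0..1} (f \<circ> f ^^ n)"
    using cont continuous_on_subset by (intro continuous_on_compose Suc) blast
  then show ?case by (simp add: o_def)
qed auto

text \<open>A closed Bowen ball for the pseudo-distance \<open>\<bar>h u - h v\<bar>\<close>, over
  an arbitrary set of times so that finite and infinite horizons share one definition.\<close>

definition shadow :: "(real \<Rightarrow> real) \<Rightarrow> real \<Rightarrow> nat set \<Rightarrow> real \<Rightarrow> real set" where
  "shadow h e I x = {u\<in>{0..1}. \<forall>i\<in>I. \<bar>h ((f ^^ i) u) - h ((f ^^ i) x)\<bar> \<le> e}"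

text \<open>The connected component of \<open>x\<close> in its \<open>h\<close>-Bowen ball.\<close>
definition tube :: "(real \<Rightarrow> real) \<Rightarrow> real \<Rightarrow> nat set \<Rightarrow> real \<Rightarrow> real set" where
  "tube h e I x = {y. closed_segment x y \<subseteq> shadow h e I x}"

lemma tube_subset_shadow: "tube h e I x \<subseteq> shadow h e I x"
  by (auto simp: tube_def)

lemma tube_subset: "tube h e I x \<subseteq> {0..1}"
  by (auto simp: tube_def shadow_def)

lemma tube_shadow: "y \<in> tube h e I x \<Longrightarrow> i \<in> I \<Longrightarrow> \<bar>h ((f ^^ i) y) - h ((f ^^ i) x)\<bar> \<le> e"
  by (auto simp: tube_def shadow_def)

lemma self_in_tube: "0 \<le> e \<Longrightarrow> x \<in> {0..1} \<Longrightarrow> x \<in> tube h e I x"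
  by (simp add: tube_def shadow_def)

lemma segment_subset_tube: "y \<in> tube h e I x \<Longrightarrow> closed_segment x y \<subseteq> tube h e I x"
proof
  fix u assume y: "y \<in> tube h e I x" and "u \<in> closed_segment x y"
  then have "closed_segment x u \<subseteq> closed_segment x y" by (simp add: subset_closed_segment)
  also have "\<dots> \<subseteq> shadow h e I x" using y by (simp add: tube_def)
  finally show "u \<in> tube h e I x" by (simp add: tube_def)
qed

lemma tube_antimono:
  assumes "I \<subseteq> J"
  shows "tube h e J x \<subseteq> tube h e I x"
proof -
  have "shadow h e J x \<subseteq> shadow h e I x" using assms by (auto simp: shadow_def)
  then show ?thesis by (auto simp: tube_def)
qed

text \<open>With tubes defined through segments, this amounts to a segment lying in an intersection
  iff it lies in every member.\<close>

lemma tube_UNIV: "tube h e UNIV x = (\<Inter>n. tube h e {..<n} x)"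
proof -
  have "shadow h e UNIV x = (\<Inter>n. shadow h e {..<n} x)" by (auto simp: shadow_def)
  then show ?thesis by (simp add: tube_def le_INF_iff) auto
qed

lemma connected_tube:
  assumes "0 \<le> e" "x \<in> {0..1}"
  shows "connected (tube h e I x)"
proof -
  have "tube h e I x = \<Union> (closed_segment x ` tube h e I x)"
    using segment_subset_tube by fastforce
  moreover have "connected (\<Union> (closed_segment x ` tube h e I x))"
    by (rule connected_Union) auto
  ultimately show ?thesis by simp
qed

lemma compact_tube:
  assumes "continuous_on UNIV h"
  shows "compact (tube h e I x)"
proof -
  have "closed {u\<in>{0..1}. \<bar>h ((f ^^ i) u) - h ((f ^^ i) x)\<bar> \<le> e}" for i
    by (intro continuous_on_closed_Collect_le continuous_intros continuous_on_funpow
          continuous_on_compose2[OF assms]) auto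
  moreover have "shadow h e I x = {0..1} \<inter> (\<Inter>i\<in>I. {u\<in>{0..1}. \<bar>h ((f ^^ i) u) - h ((f ^^ i) x)\<bar> \<le> e})"
    by (auto simp: shadow_def)
  ultimately have cl: "closed (shadow h e I x)" by (auto intro!: closed_Int closed_INT)
  \<comment> \<open>One condition for each position \<open>s\<close> on the segment exhibits the
    tube as an intersection of preimages of a closed set under affine maps.\<close>
  have "tube h e I x = (\<Inter>s\<in>{0..1}. (\<lambda>y. (1 - s) * x + s * y) -` shadow h e I x)"
  proof (intro set_eqI iffI)
    fix y assume "y \<in> tube h e I x"
    then show "y \<in> (\<Inter>s\<in>{0..1}. (\<lambda>y. (1 - s) * x + s * y) -` shadow h e I x)"
      by (fastforce simp: tube_def closed_segment_def)
  next
    fix y assume "y \<in> (\<Inter>s\<in>{0..1}. (\<lambda>y. (1 - s) * x + s * y) -` shadow h e I x)"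
    then show "y \<in> tube h e I x" by (auto simp: tube_def closed_segment_def)
  qed
  moreover have "closed \<dots>"
    by (intro closed_INT ballI continuous_closed_vimage cl continuous_intros)
  ultimately have "closed (tube h e I x)" by simp
  then have "compact (tube h e I x \<inter> {0..1})" by (intro closed_Int_compact compact_Icc)
  moreover have "tube h e I x \<inter> {0..1} = tube h e I x" using tube_subset by blast
  ultimately show ?thesis by simp
qed

text \<open>The image of the segment from \<open>x\<close> to \<open>y\<close> is connected, so it
  contains the segment between the images; shifting times by \<open>k\<close> turns shadowing over
  \<open>J\<close> into shadowing over \<open>I\<close>.\<close>

lemma funpow_tube:
  assumes "0 \<le> e" "x \<in> {0..1}" "\<And>i. i \<in> I \<Longrightarrow> i + k \<in> J"
  shows "(f ^^ k) ` tube h e J x \<subseteq> tube h e I ((f ^^ k) x)"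
proof (rule image_subsetI)
  fix y assume y: "y \<in> tube h e J x"
  have seg: "closed_segment x y \<subseteq> tube h e J x" using y by (rule segment_subset_tube)
  then have "connected ((f ^^ k) ` closed_segment x y)"
    using tube_subset by (intro connected_continuous_image continuous_on_subset[OF continuous_on_funpow]) blast+
  then have "closed_segment ((f ^^ k) x) ((f ^^ k) y) \<subseteq> (f ^^ k) ` closed_segment x y"
    by (intro closed_segment_subset is_interval_convex) (auto simp: is_interval_connected_1)
  also have "\<dots> \<subseteq> (f ^^ k) ` tube h e J x" using seg by blast
  also have "\<dots> \<subseteq> shadow h e I ((f ^^ k) x)"
  proof (rule image_subsetI)
    fix u assume u: "u \<in> tube h e J x"
    then have "(f ^^ k) u \<in> {0..1}" using tube_subset by (intro funpow_mem) blast
    moreover have "\<bar>h ((f ^^ i) ((f ^^ k) u)) - h ((f ^^ i) ((f ^^ k) x))\<bar> \<le> e" if "i \<in> I" for i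
      using tube_shadow[OF u assms(3)[OF that]] by (simp add: funpow_add)
    ultimately show "(f ^^ k) u \<in> shadow h e I ((f ^^ k) x)" by (simp add: shadow_def)
  qed
  finally show "(f ^^ k) y \<in> tube h e I ((f ^^ k) x)" by (simp add: tube_def)
qed

lemma tube_neighbourhood:
  assumes "continuous_on UNIV h" "0 < e" "x \<in> {0..1}"
  shows "\<exists>d>0. {x - d..x + d} \<inter> {0..1} \<subseteq> tube h e {..<n} x"
proof -
  have "\<forall>\<^sub>F u in at x within {0..1}. \<forall>i\<in>{..<n}. \<bar>h ((f ^^ i) u) - h ((f ^^ i) x)\<bar> < e"
  proof (intro eventually_ball_finite ballI)
    fix i
    have "continuous_on {0..1} (\<lambda>u. h ((f ^^ i) u))"
      by (intro continuous_on_compose2[OF assms(1)] continuous_on_funpow) auto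
    then have "((\<lambda>u. h ((f ^^ i) u)) \<longlongrightarrow> h ((f ^^ i) x)) (at x within {0..1})"
      using assms(3) by (auto simp: continuous_on)
    from tendstoD[OF this assms(2)]
    show "\<forall>\<^sub>F u in at x within {0..1}. \<bar>h ((f ^^ i) u) - h ((f ^^ i) x)\<bar> < e"
      by (simp add: dist_real_def)
  qed auto
  then obtain d where d: "d > 0" "\<And>u. u \<in> {0..1} \<Longrightarrow> u \<noteq> x \<Longrightarrow> dist u x < d \<Longrightarrow>
      \<forall>i\<in>{..<n}. \<bar>h ((f ^^ i) u) - h ((f ^^ i) x)\<bar> < e"
    by (auto simp: eventually_at)
  have "{x - d/2..x + d/2} \<inter> {0..1} \<subseteq> tube h e {..<n} x"
  proof
    fix y assume y: "y \<in> {x - d/2..x + d/2} \<inter> {0..1}"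
    have "u \<in> shadow h e {..<n} x" if "u \<in> closed_segment x y" for u
    proof -
      have "u \<in> {0..1}" "dist u x < d"
        using that y assms(3) d(1) by (auto simp: closed_segment_eq_real_ivl dist_real_def abs_if split: if_splits)
      then show ?thesis using d(2)[of u] assms(2) by (cases "u = x") (auto simp: shadow_def less_imp_le)
    qed
    then show "y \<in> tube h e {..<n} x" by (auto simp: tube_def)
  qed
  with d(1) show ?thesis by (intro exI[of _ "d/2"]) auto
qed

text \<open>Otherwise the orbit would spend a positive fraction of its time near \<open>p\<close>, so \<open>h\<close> would jump there.\<close>
lemma generic_not_convergent:
  assumes "generic f h x" "continuous_on UNIV h" "n > 0"
  shows "\<not> (\<lambda>j. (f ^^ (n * j)) x) \<longlonglongrightarrow> p"
proof
  assume lim: "(\<lambda>j. (f ^^ (n * j)) x) \<longlonglongrightarrow> p"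
  have "isCont h p" using assms(2) by (simp add: continuous_on_eq_continuous_at)
  then have "(h \<longlongrightarrow> h p) (nhds p)" by (simp add: continuous_at tendsto_at_iff_tendsto_nhds)
  moreover have "0 < 1 / (4 * real n)" using assms(3) by simp
  ultimately have "\<forall>\<^sub>F u in nhds p. dist (h u) (h p) < 1 / (4 * real n)" by (rule tendstoD)
  then obtain d where d: "d > 0" "\<And>u. dist u p < d \<Longrightarrow> dist (h u) (h p) < 1 / (4 * real n)"
    by (auto simp: eventually_nhds_metric)
  define a b where "a = p - d/2" and "b = p + d/2"
  have "h b - h a < 1 / (2 * real n)"
    using d(2)[of a] d(2)[of b] d(1) by (auto simp: a_def b_def dist_real_def abs_less_iff field_simps)
  have "\<forall>\<^sub>F j in sequentially. dist ((f ^^ (n * j)) x) p < d/2" using d(1) by (intro tendstoD[OF lim]) simp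
  then obtain J where J: "\<And>j. j \<ge> J \<Longrightarrow> dist ((f ^^ (n * j)) x) p < d/2" by (auto simp: eventually_sequentially)
  \<comment> \<open>From \<open>J\<close> on, every time \<open>n * j\<close> is spent in
    \<open>(a, b]\<close>, so this interval has frequency at least \<open>1 / n\<close> in the
    limit, while \<open>h b - h a\<close> is less than half of that.\<close>
  have le: "1 / real n - real J / real (n * N) \<le> orbit_cdf f (n * N) x b - orbit_cdf f (n * N) x a" if "N > 0" for N
  proof -
    have "(\<lambda>j. n * j) ` {J..<N} \<subseteq> {i. i < n * N \<and> (f ^^ i) x \<le> b} - {i. i < n * N \<and> (f ^^ i) x \<le> a}"
    proof (rule image_subsetI)
      fix j assume "j \<in> {J..<N}"
      with J[of j] assms(3)
      show "n * j \<in> {i. i < n * N \<and> (f ^^ i) x \<le> b} - {i. i < n * N \<and> (f ^^ i) x \<le> a}"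
        by (auto simp: a_def b_def dist_real_def abs_if field_simps split: if_splits)
    qed
    then have "card ((\<lambda>j. n * j) ` {J..<N}) \<le> card ({i. i < n * N \<and> (f ^^ i) x \<le> b} - {i. i < n * N \<and> (f ^^ i) x \<le> a})"
      by (intro card_mono) auto
    also have "\<dots> = card {i. i < n * N \<and> (f ^^ i) x \<le> b} - card {i. i < n * N \<and> (f ^^ i) x \<le> a}"
      using d(1) by (intro card_Diff_subset) (auto simp: a_def b_def)
    finally have "N - J \<le> card {i. i < n * N \<and> (f ^^ i) x \<le> b} - card {i. i < n * N \<and> (f ^^ i) x \<le> a}"
      using assms(3) by (subst (asm) card_image) (auto simp: inj_on_def)
    moreover have "card {i. i < n * N \<and> (f ^^ i) x \<le> a} \<le> card {i. i < n * N \<and> (f ^^ i) x \<le> b}"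
      using d(1) by (intro card_mono) (auto simp: a_def b_def)
    ultimately have "real N - real J \<le> real (card {i. i < n * N \<and> (f ^^ i) x \<le> b}) - real (card {i. i < n * N \<and> (f ^^ i) x \<le> a})"
      by linarith
    then have "(real N - real J) / real (n * N) \<le>
      (real (card {i. i < n * N \<and> (f ^^ i) x \<le> b}) - real (card {i. i < n * N \<and> (f ^^ i) x \<le> a})) / real (n * N)"
      by (rule divide_right_mono) simp
    then show ?thesis using that assms(3) by (simp add: orbit_cdf_def diff_divide_distrib)
  qed
  have sub: "filterlim (\<lambda>N. n * N) sequentially sequentially"
    using assms(3) by (intro filterlim_subseq) (auto simp: strict_mono_def)
  have "(\<lambda>N. orbit_cdf f (n * N) x b - orbit_cdf f (n * N) x a) \<longlonglongrightarrow> h b - h a"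
    by (intro tendsto_diff filterlim_compose[OF genericD[OF assms(1)] sub])
  moreover have "(\<lambda>N. 1 / real n - real J / real (n * N)) \<longlonglongrightarrow> 1 / real n - 0"
    by (intro tendsto_diff tendsto_const filterlim_compose[OF lim_const_over_n sub])
  ultimately have "1 / real n - 0 \<le> h b - h a"
    using le by (intro LIMSEQ_le) (auto intro!: exI[of _ 1])
  with \<open>h b - h a < 1 / (2 * real n)\<close> assms(3) show False by (simp add: field_simps)
qed

text \<open>Without a fixed point of \<open>f ^^ n\<close> in the successive images of the tube, the
  displacement under \<open>f ^^ n\<close> would keep one sign along them, so the points
  \<open>(f ^^ (n * j)) x\<close> would be monotone and hence convergent, against
  \<open>generic_not_convergent\<close>.\<close>

lemma periodic_point_in_returning_tube:
  assumes "generic f h x" "continuous_on UNIV h" "x \<in> {0..1}" "0 \<le> e" "n > 0"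
    and ret: "(f ^^ n) x \<in> tube h e UNIV x"
  shows "\<exists>j. \<exists>z\<in>tube h e UNIV ((f ^^ (n * j)) x). (f ^^ n) z = z"
proof (rule ccontr)
  assume none: "\<not> ?thesis"
  define F where "F = f ^^ n"
  define B where "B = tube h e UNIV x"
  define D where "D j = (f ^^ (n * j)) ` B" for j
  have Fit: "F ((f ^^ (n * j)) u) = (f ^^ (n * Suc j)) u" for j u
    by (simp add: F_def funpow_add)
  have cF: "continuous_on {0..1} F" unfolding F_def by (rule continuous_on_funpow)
  have B01: "B \<subseteq> {0..1}" unfolding B_def by (rule tube_subset)
  have D01: "D j \<subseteq> {0..1}" for j using B01 funpow_mem unfolding D_def by blast
  have Dcon: "connected (D j)" for j
    unfolding D_def B_def using assms(3,4) tube_subset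
    by (intro connected_continuous_image connected_tube continuous_on_subset[OF continuous_on_funpow]) auto
  have Dne: "F u \<noteq> u" if "u \<in> D j" for j u
  proof -
    have "D j \<subseteq> tube h e UNIV ((f ^^ (n * j)) x)"
      unfolding D_def B_def using assms by (intro funpow_tube) auto
    with none that show ?thesis by (auto simp: F_def)
  qed
  have xB: "x \<in> B" unfolding B_def using assms by (intro self_in_tube) auto
  have xD: "(f ^^ (n * j)) x \<in> D j" for j using xB by (simp add: D_def)
  \<comment> \<open>The return hypothesis enters here: the image of \<open>(f ^^ n) x\<close>, a
    point of \<open>B\<close>, is the base point of the next set, so \<open>D j\<close> and
    \<open>D (Suc j)\<close> meet.\<close>
  have xD': "(f ^^ (n * Suc j)) x \<in> D j" for j
  proof -
    have "(f ^^ (n * Suc j)) x = (f ^^ (n * j)) ((f ^^ n) x)"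
      by (simp add: funpow_add[symmetric, THEN fun_cong, simplified] add.commute)
    then show ?thesis using ret by (simp add: D_def B_def)
  qed
  \<comment> \<open>consecutive \<open>D j\<close> overlap, so the sign of \<open>F u - u\<close> is the same on all of them\<close>
  define s where "s = sgn (F x - x)"
  have s: "s * (F x - x) > 0" "s = 1 \<or> s = -1"
    using Dne[of x 0] xD[of 0] by (auto simp: s_def sgn_if)
  have same: "s * (F u - u) > 0" if "a \<in> D j" "s * (F a - a) > 0" "u \<in> D j" for a u j
  proof (rule pos_if_no_zero[of "D j" "\<lambda>u. s * (F u - u)" a])
    show "continuous_on (D j) (\<lambda>u. s * (F u - u))"
      by (intro continuous_intros continuous_on_subset[OF cF] D01)
  qed (use that Dcon Dne s in auto)
  have pos: "\<forall>u\<in>D j. s * (F u - u) > 0" for j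
  proof (induction j)
    case 0
    then show ?case using same[of x 0] s(1) xD[of 0] by auto
  next
    case (Suc j)
    then show ?case using same[OF xD[of "Suc j"]] xD'[of j] by blast
  qed
  define y where "y j = (f ^^ (n * j)) x" for j
  have step: "s * (y (Suc j) - y j) > 0" for j
    using bspec[OF pos xD[of j]] unfolding Fit y_def .
  from s(2) have "monoseq y"
  proof
    assume "s = 1"
    then have "y j \<le> y (Suc j)" for j using step[of j] by simp
    then show ?thesis by (intro incseq_imp_monoseq incseq_SucI)
  next
    assume "s = -1"
    then have "y (Suc j) \<le> y j" for j using step[of j] by simp
    then show ?thesis by (intro decseq_imp_monoseq decseq_SucI)
  qed
  moreover have "Bseq y"
    using funpow_mem[OF assms(3)] by (intro BseqI'[of _ 1]) (auto simp: y_def)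
  ultimately have "convergent y" by (rule Bseq_monoseq_convergent[rotated])
  then show False using generic_not_convergent[OF assms(1,2,5)] by (auto simp: convergent_def y_def[abs_def])
qed

text \<open>Without such an exit the tubes would stop shrinking at time \<open>N\<close>; the
  infinite tube would then contain a neighbourhood of \<open>x\<close>, on which \<open>h\<close> is
  constant by \<open>const\<close>, contradicting \<open>supp\<close>.\<close>

lemma ex_tube_exit:
  assumes "continuous_on UNIV h" "h 0 = 0" "h 1 = 1" "\<And>t. 0 \<le> h t \<and> h t \<le> 1"
    and "x \<in> {0..1}" "0 < e"
    and supp: "\<And>d. d > 0 \<Longrightarrow> h (x - d) < h (x + d)"
    and const: "\<And>y. y \<in> tube h e UNIV x \<Longrightarrow> h y = h x"
  shows "\<exists>n\<ge>N. \<exists>u\<in>tube h e {..<n} x. \<bar>h ((f ^^ n) u) - h ((f ^^ n) x)\<bar> > e"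
proof (rule ccontr)
  assume "\<not> ?thesis"
  then have no: "\<And>n u. n \<ge> N \<Longrightarrow> u \<in> tube h e {..<n} x \<Longrightarrow> \<bar>h ((f ^^ n) u) - h ((f ^^ n) x)\<bar> \<le> e"
    by force
  have "tube h e {..<N} x \<subseteq> tube h e {..<n} x" for n
  proof (induction n)
    case 0
    show ?case by (rule tube_antimono) simp
  next
    case (Suc n)
    show ?case
    proof (cases "n < N")
      case True
      then show ?thesis by (intro tube_antimono) auto
    next
      case False
      show ?thesis
      proof
        fix y assume "y \<in> tube h e {..<N} x"
        then have seg: "closed_segment x y \<subseteq> tube h e {..<n} x"
          using Suc segment_subset_tube by blast
        have "u \<in> shadow h e {..<Suc n} x" if "u \<in> closed_segment x y" for u
        proof -
          have "u \<in> tube h e {..<n} x" using seg that by blast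
          then have "u \<in> shadow h e {..<n} x" "\<bar>h ((f ^^ n) u) - h ((f ^^ n) x)\<bar> \<le> e"
            using no[of n u] False by (simp_all add: subsetD[OF tube_subset_shadow])
          then show ?thesis by (simp add: shadow_def lessThan_Suc)
        qed
        then show "y \<in> tube h e {..<Suc n} x" by (auto simp: tube_def)
      qed
    qed
  qed
  then have sub: "tube h e {..<N} x \<subseteq> tube h e UNIV x" by (auto simp: tube_UNIV)
  obtain d where d: "d > 0" "{x - d..x + d} \<inter> {0..1} \<subseteq> tube h e {..<N} x"
    using tube_neighbourhood[OF assms(1,6,5)] by blast
  \<comment> \<open>Truncating to the unit interval loses nothing: \<open>h 0 = 0\<close> and
    \<open>h 1 = 1\<close> are the extreme values of \<open>h\<close>.\<close>
  define a b where "a = max 0 (x - d)" and "b = min 1 (x + d)"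
  have "a \<in> {x - d..x + d} \<inter> {0..1}" "b \<in> {x - d..x + d} \<inter> {0..1}"
    using d(1) assms(5) by (auto simp: a_def b_def)
  with d(2) sub const have "h a = h x" "h b = h x" by blast+
  moreover have "h a \<le> h (x - d)"
    using assms(2,4) by (auto simp: a_def max_def)
  moreover have "h (x + d) \<le> h b"
    using assms(3,4) by (auto simp: b_def min_def)
  ultimately show False using supp[OF d(1)] by simp
qed

text \<open>The shift \<open>k\<close> is chosen before \<open>N\<close>: the point
  \<open>(f ^^ k) x\<close> stays fixed while the period grows, so that uniform equidistribution of
  this one orbit can be used afterwards.\<close>

lemma ex_shadowing_periodic:
  assumes gen: "generic f h x" and hc: "continuous_on UNIV h" and h0: "h 0 = 0" and h1: "h 1 = 1"
    and x: "x \<in> {0..1}" and supp: "\<And>d. d > 0 \<Longrightarrow> h (x - d) < h (x + d)" and e: "0 < e"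
  shows "\<exists>k. \<forall>N. \<exists>m\<ge>N. \<exists>z\<in>{0..1}. m > 0 \<and> (f ^^ m) z = z \<and>
           (\<forall>i<m. \<bar>h ((f ^^ i) z) - h ((f ^^ (k + i)) x)\<bar> \<le> e)"
proof (cases "\<exists>k n. n > 0 \<and> (f ^^ (k + n)) x \<in> tube h e UNIV ((f ^^ k) x)")
  case True
  then obtain k n where n: "n > 0" "(f ^^ n) ((f ^^ k) x) \<in> tube h e UNIV ((f ^^ k) x)"
    by (metis add.commute funpow_add o_apply)
  then obtain j z where z: "z \<in> tube h e UNIV ((f ^^ (n * j)) ((f ^^ k) x))" "(f ^^ n) z = z"
    using periodic_point_in_returning_tube[OF generic_funpow[OF gen] hc funpow_mem[OF x] _ n] e by force
  show ?thesis
  proof (rule exI[of _ "n * j + k"], rule allI)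
    fix N
    \<comment> \<open>Since \<open>z\<close> shadows the orbit forever, a multiple of
      \<open>n\<close> serves as an arbitrarily long period.\<close>
    have "(f ^^ (n * Suc N)) z = z" unfolding funpow_mult[symmetric] using z(2) by (induction N) auto
    moreover have "z \<in> {0..1}" using z(1) tube_subset by blast
    moreover have "\<bar>h ((f ^^ i) z) - h ((f ^^ (n * j + k + i)) x)\<bar> \<le> e" for i
      using tube_shadow[OF z(1), of i] by (simp add: funpow_add[symmetric, THEN fun_cong, simplified] add.commute add.left_commute)
    moreover have "N \<le> n * Suc N" using n(1) by (simp add: Suc_leI trans_le_add2)
    ultimately show "\<exists>m\<ge>N. \<exists>z\<in>{0..1}. m > 0 \<and> (f ^^ m) z = z \<and>
           (\<forall>i<m. \<bar>h ((f ^^ i) z) - h ((f ^^ (n * j + k + i)) x)\<bar> \<le> e)"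
      using n(1) by (intro exI[of _ "n * Suc N"]) auto
  qed
next
  case False
  note mono = generic_mono[OF gen]
  have bounds: "0 \<le> h t \<and> h t \<le> 1" for t
    using LIMSEQ_le_const[OF genericD[OF gen, of t], of 0] LIMSEQ_le_const2[OF genericD[OF gen, of t], of 1]
      orbit_cdf_bounds by blast
  \<comment> \<open>Without returns, infinite tubes have \<open>h\<close>-length zero: otherwise a
    later orbit point falls between \<open>y\<close> and \<open>(f ^^ k) x\<close>, hence into the
    tube, which is a return.\<close>
  have const: "h y = h ((f ^^ k) x)" if y: "y \<in> tube h e UNIV ((f ^^ k) x)" for k y
  proof (rule ccontr)
    assume "h y \<noteq> h ((f ^^ k) x)"
    define p q where "p = min y ((f ^^ k) x)" and "q = max y ((f ^^ k) x)"
    have "p \<le> q" by (simp add: p_def q_def)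
    then have "h p \<le> h q" by (rule monoD[OF mono])
    moreover have "h p \<noteq> h q" using \<open>h y \<noteq> _\<close> by (auto simp: p_def q_def min_def max_def)
    ultimately have "h p < h q" by simp
    then obtain i where i: "i \<ge> Suc k" "h p < h ((f ^^ i) x)" "h ((f ^^ i) x) < h q"
      using generic_visits[OF gen hc] by blast
    then have "p < (f ^^ i) x" "(f ^^ i) x < q"
      using monoD[OF mono, of "(f ^^ i) x" p] monoD[OF mono, of q "(f ^^ i) x"] by fastforce+
    then have "(f ^^ i) x \<in> closed_segment ((f ^^ k) x) y"
      by (auto simp: closed_segment_eq_real_ivl p_def q_def)
    then have "(f ^^ (k + (i - k))) x \<in> tube h e UNIV ((f ^^ k) x)"
      using segment_subset_tube[OF y] i(1) by auto
    moreover have "i - k > 0" using i(1) by simp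
    ultimately show False using False by blast
  qed
  define J where "J n = (f ^^ n) ` tube h e {..<n} x" for n
  have Jcon: "connected (J n)" for n
    unfolding J_def using e x tube_subset
    by (intro connected_continuous_image connected_tube continuous_on_subset[OF continuous_on_funpow]) auto
  have xJ: "(f ^^ n) x \<in> J n" for n unfolding J_def using e x by (intro imageI self_in_tube) auto
  have "\<exists>n\<ge>N. \<exists>l\<in>J n. \<exists>r\<in>J n. h l + e < h r" for N
  proof -
    from ex_tube_exit[OF hc h0 h1 bounds x e supp const[of _ 0, simplified], of N]
    obtain n u where n: "n \<ge> N" "u \<in> tube h e {..<n} x" "\<bar>h ((f ^^ n) u) - h ((f ^^ n) x)\<bar> > e" by blast
    moreover have "(f ^^ n) u \<in> J n" using n by (simp add: J_def)
    ultimately have "(\<exists>l\<in>J n. \<exists>r\<in>J n. h l + e < h r)"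
      using xJ[of n] by (cases "h ((f ^^ n) u) < h ((f ^^ n) x)") force+
    with n(1) show ?thesis by blast
  qed
  \<comment> \<open>Endpoints are chosen for every \<open>n\<close>; where \<open>J n\<close> is
    short they are arbitrary points of it.\<close>
  then have ex: "\<forall>n. \<exists>l r. l \<in> J n \<and> r \<in> J n \<and> ((\<exists>l\<in>J n. \<exists>r\<in>J n. h l + e < h r) \<longrightarrow> h l + e < h r)"
    using xJ by blast
  obtain l r where lr: "\<And>n. l n \<in> J n" "\<And>n. r n \<in> J n"
      "\<And>n. (\<exists>l\<in>J n. \<exists>r\<in>J n. h l + e < h r) \<Longrightarrow> h (l n) + e < h (r n)"
    using ex by metis
  have "\<exists>n\<ge>N. 0 \<le> h (l n) \<and> h (r n) \<le> 1 \<and> h (l n) + e < h (r n)" for N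
    using \<open>\<And>N. \<exists>n\<ge>N. \<exists>l\<in>J n. \<exists>r\<in>J n. h l + e < h r\<close>[of N] lr(3) bounds by blast
  from infinite_common_band[OF e this] obtain a b
    where ab: "0 \<le> a" "a < b" "b \<le> 1" and inf: "infinite {n. h (l n) \<le> a \<and> b \<le> h (r n)}" by blast
  define V where "V = {u. a < h u \<and> h u < b}"
  have "open V" unfolding V_def
    by (intro open_Collect_conj open_Collect_less continuous_on_const hc)
  have VJ: "V \<subseteq> J n" if "h (l n) \<le> a" "b \<le> h (r n)" for n
  proof
    fix u assume "u \<in> V"
    with that have "h (l n) < h u" "h u < h (r n)" by (auto simp: V_def)
    then have "l n \<le> u" "u \<le> r n"
      using monoD[OF mono, of u "l n"] monoD[OF mono, of "r n" u] by linarith+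
    then show "u \<in> J n" using connectedD_interval[OF Jcon lr(1,2)] by blast
  qed
  obtain a' b' where "h a' = a" "h b' = b"
    using generic_ex_value[OF gen hc h0 h1] ab by (meson less_imp_le order_trans)
  then obtain k where k: "(f ^^ k) x \<in> V"
    using generic_visits[OF gen hc, of a' b' 0] ab by (auto simp: V_def)
  define y where "y = (f ^^ k) x"
  have y: "y \<in> {0..1}" unfolding y_def by (rule funpow_mem[OF x])
  \<comment> \<open>The compact sets left after removing \<open>V\<close> are nested; a common point
    would lie in the infinite tube of \<open>y\<close>, where \<open>h\<close> equals
    \<open>h y\<close>, a value in \<open>(a, b)\<close>, and so would belong to
    \<open>V\<close>.\<close>
  have "\<exists>M. tube h e {..<M} y \<subseteq> V"
  proof (rule ccontr)
    assume "\<nexists>M. tube h e {..<M} y \<subseteq> V"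
    then have "tube h e {..<M} y - V \<noteq> {}" for M by blast
    moreover have "compact (tube h e {..<M} y - V)" for M
      using compact_tube[OF hc] \<open>open V\<close> by (rule compact_diff)
    moreover have "tube h e {..<n} y - V \<subseteq> tube h e {..<m} y - V" if "m \<le> n" for m n
      using tube_antimono[of "{..<m}" "{..<n}"] that by fastforce
    ultimately have "(\<Inter>M. tube h e {..<M} y - V) \<noteq> {}" by (intro compact_nest)
    then obtain u where "u \<in> tube h e UNIV y" "u \<notin> V" by (auto simp: tube_UNIV)
    with const[of u k] k show False by (auto simp: V_def y_def)
  qed
  then obtain M where M: "tube h e {..<M} y \<subseteq> V" by blast
  show ?thesis
  proof (rule exI[of _ k], rule allI)
    fix N
    \<comment> \<open>The bound makes \<open>m = n - k\<close> positive and at least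
      \<open>N\<close> and \<open>M\<close>, so that the period is long and the tube of length
      \<open>m\<close> fits into \<open>V\<close>.\<close>
    obtain n where n: "n \<ge> Suc (N + M + k)" "h (l n) \<le> a" "b \<le> h (r n)"
      using inf unfolding infinite_nat_iff_unbounded_le by blast
    define m where "m = n - k"
    have m: "m \<ge> N" "m \<ge> M" "m > 0" "n = m + k" using n(1) by (auto simp: m_def)
    define C where "C = tube h e {..<m} y"
    \<comment> \<open>The chain shows that \<open>f ^^ m\<close> maps \<open>C\<close> over itself:
      \<open>C\<close> fits into \<open>V\<close>, \<open>V\<close> into \<open>J n\<close>, and the
      last \<open>m\<close> steps towards \<open>J n\<close> start inside \<open>C\<close>.\<close>
    have "C \<subseteq> V" using M tube_antimono[of "{..<M}" "{..<m}"] m(2) unfolding C_def by fastforce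
    also have "V \<subseteq> J n" using VJ n by blast
    also have "J n = (f ^^ m) ` (f ^^ k) ` tube h e {..<n} x"
      by (simp add: J_def m(4) funpow_add image_comp)
    also have "\<dots> \<subseteq> (f ^^ m) ` C"
      unfolding C_def y_def using e x m by (intro image_mono funpow_tube) auto
    finally have "C \<subseteq> (f ^^ m) ` C" .
    moreover have "compact C" "connected C" "C \<noteq> {}"
      unfolding C_def using self_in_tube[of e y h "{..<m}"] y e
      by (blast intro: compact_tube[OF hc] connected_tube less_imp_le)+
    moreover have "continuous_on C (f ^^ m)"
      using tube_subset unfolding C_def by (rule continuous_on_subset[OF continuous_on_funpow])
    ultimately obtain z where z: "z \<in> C" "(f ^^ m) z = z" using fixed_point_of_covering by metis
    have "\<bar>h ((f ^^ i) z) - h ((f ^^ (k + i)) x)\<bar> \<le> e" if "i < m" for i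
      using tube_shadow[OF z(1)[unfolded C_def], of i] that
      by (simp add: y_def funpow_add[symmetric, THEN fun_cong, simplified] add.commute)
    moreover have "z \<in> {0..1}" using z(1) tube_subset unfolding C_def by blast
    ultimately show "\<exists>m\<ge>N. \<exists>z\<in>{0..1}. m > 0 \<and> (f ^^ m) z = z \<and>
           (\<forall>i<m. \<bar>h ((f ^^ i) z) - h ((f ^^ (k + i)) x)\<bar> \<le> e)"
      using m z(2) by blast
  qed
qed

text \<open>Shadowing moves the \<open>h\<close>-level of an orbit point by at most
  \<open>c\<close>, so the orbit of \<open>z\<close> below \<open>t\<close> is compared with the
  orbit of \<open>y\<close> below a threshold of slightly different level, where uniform
  equidistribution applies.\<close>

theorem ex_periodic_orbit_cdf_close:
  assumes gen: "generic f h x" and hc: "continuous_on UNIV h" and h0: "h 0 = 0" and h1: "h 1 = 1"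
    and x: "x \<in> {0..1}" and supp: "\<And>d. d > 0 \<Longrightarrow> h (x - d) < h (x + d)" and e: "0 < e"
  shows "\<exists>m>0. \<exists>z\<in>{0..1}. (f ^^ m) z = z \<and> (\<forall>t. \<bar>orbit_cdf f m z t - h t\<bar> \<le> e)"
proof -
  \<comment> \<open>\<open>2 * c\<close> is spent on the level of the threshold and \<open>c\<close>
    on uniform convergence. The doubled shift makes the inequality between values of
    \<open>h\<close> strict, so that monotonicity turns it into an order of points.\<close>
  define c where "c = e / 3"
  have c: "c > 0" using e by (simp add: c_def)
  obtain k where k: "\<And>N. \<exists>m\<ge>N. \<exists>z\<in>{0..1}. m > 0 \<and> (f ^^ m) z = z \<and>
           (\<forall>i<m. \<bar>h ((f ^^ i) z) - h ((f ^^ (k + i)) x)\<bar> \<le> c)"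
    using ex_shadowing_periodic[OF gen hc h0 h1 x supp c] by blast
  define y where "y = (f ^^ k) x"
  note mono = generic_mono[OF gen]
  have geny: "generic f h y" unfolding y_def by (rule generic_funpow[OF gen])
  have bounds: "0 \<le> h t" "h t \<le> 1" for t
    using LIMSEQ_le_const[OF genericD[OF gen, of t], of 0] LIMSEQ_le_const2[OF genericD[OF gen, of t], of 1]
      orbit_cdf_bounds by blast+
  obtain N where N: "\<And>n t. n \<ge> N \<Longrightarrow> \<bar>orbit_cdf f n y t - h t\<bar> \<le> c"
    using generic_uniform[OF geny hc h0 h1 c] by (auto simp: eventually_sequentially)
  obtain m z where m: "m \<ge> N" "m > 0" and z: "z \<in> {0..1}" "(f ^^ m) z = z"
    and "\<And>i. i < m \<Longrightarrow> \<bar>h ((f ^^ i) z) - h ((f ^^ (k + i)) x)\<bar> \<le> c" using k[of N] by blast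
  then have sh: "\<And>i. i < m \<Longrightarrow> \<bar>h ((f ^^ i) z) - h ((f ^^ i) y)\<bar> \<le> c"
    by (simp add: y_def funpow_add[symmetric, THEN fun_cong, simplified] add.commute)
  have up: "orbit_cdf f m z t \<le> h t + e" for t
  proof (cases "h t + 2 * c \<le> 1")
    case True
    then obtain s where s: "h s = h t + 2 * c"
      using generic_ex_value[OF gen hc h0 h1, of "h t + 2 * c"] bounds(1)[of t] c by auto
    have "(f ^^ i) y \<le> s" if "i < m" "(f ^^ i) z \<le> t" for i
    proof -
      have "h ((f ^^ i) y) \<le> h ((f ^^ i) z) + c" using sh[OF that(1)] by linarith
      also have "\<dots> \<le> h t + c" using monoD[OF mono that(2)] by simp
      also have "\<dots> < h s" using s c by simp
      finally show ?thesis using monoD[OF mono, of s "(f ^^ i) y"] by linarith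
    qed
    then have "orbit_cdf f m z t \<le> orbit_cdf f m y s"
      unfolding orbit_cdf_def by (intro divide_right_mono of_nat_mono card_mono) auto
    also have "\<dots> \<le> h s + c" using N[OF m(1), of s] by linarith
    finally show ?thesis using s by (simp add: c_def)
  next
    case False
    then show ?thesis using orbit_cdf_bounds(2)[of f m z t] c by (simp add: c_def)
  qed
  have lo: "h t - e \<le> orbit_cdf f m z t" for t
  proof (cases "0 \<le> h t - 2 * c")
    case True
    then obtain s where s: "h s = h t - 2 * c"
      using generic_ex_value[OF gen hc h0 h1, of "h t - 2 * c"] bounds(2)[of t] c by auto
    have "(f ^^ i) z \<le> t" if "i < m" "(f ^^ i) y \<le> s" for i
    proof -
      have "h ((f ^^ i) z) \<le> h ((f ^^ i) y) + c" using sh[OF that(1)] by linarith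
      also have "\<dots> \<le> h s + c" using monoD[OF mono that(2)] by simp
      also have "\<dots> < h t" using s c by simp
      finally show ?thesis using monoD[OF mono, of t "(f ^^ i) z"] by linarith
    qed
    then have "orbit_cdf f m y s \<le> orbit_cdf f m z t"
      unfolding orbit_cdf_def by (intro divide_right_mono of_nat_mono card_mono) auto
    moreover have "h s - c \<le> orbit_cdf f m y s" using N[OF m(1), of s] by linarith
    ultimately show ?thesis using s by (simp add: c_def)
  next
    case False
    then show ?thesis using orbit_cdf_bounds(1)[of f m z t] c by (simp add: c_def)
  qed
  have "\<bar>orbit_cdf f m z t - h t\<bar> \<le> e" for t using up[of t] lo[of t] by linarith
  with m(2) z show ?thesis by blast
qed

end

section \<open>The ergodic theorem\<close>

definition ergodic_sum :: "('a \<Rightarrow> 'a) \<Rightarrow> ('a \<Rightarrow> real) \<Rightarrow> nat \<Rightarrow> 'a \<Rightarrow> real" where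
  "ergodic_sum T \<phi> n x = (\<Sum>i<n. \<phi> ((T ^^ i) x))"

lemma ergodic_sum_Suc: "ergodic_sum T \<phi> (Suc n) x = \<phi> x + ergodic_sum T \<phi> n (T x)"
  unfolding ergodic_sum_def by (subst sum.lessThan_Suc_shift) (simp add: funpow_swap1)

text \<open>The recursion computes the maximum of the Birkhoff sums of lengths \<open>0\<close> to
  \<open>n\<close>, in the form that the maximal inequality uses.\<close>

primrec max_ergodic_sum :: "('a \<Rightarrow> 'a) \<Rightarrow> ('a \<Rightarrow> real) \<Rightarrow> nat \<Rightarrow> 'a \<Rightarrow> real" where
  "max_ergodic_sum T \<phi> 0 x = 0"
| "max_ergodic_sum T \<phi> (Suc n) x = max 0 (\<phi> x + max_ergodic_sum T \<phi> n (T x))"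

lemma max_ergodic_sum_nonneg: "0 \<le> max_ergodic_sum T \<phi> n x"
  by (cases n) auto

lemma max_ergodic_sum_Suc_mono: "max_ergodic_sum T \<phi> n x \<le> max_ergodic_sum T \<phi> (Suc n) x"
proof (induction n arbitrary: x)
  case (Suc n)
  show ?case using Suc[of "T x"] by (auto simp: max_def)
qed simp

lemma max_ergodic_sum_mono: "m \<le> n \<Longrightarrow> max_ergodic_sum T \<phi> m x \<le> max_ergodic_sum T \<phi> n x"
  by (rule lift_Suc_mono_le[of "\<lambda>n. max_ergodic_sum T \<phi> n x"]) (rule max_ergodic_sum_Suc_mono)

lemma ergodic_sum_le_max: "ergodic_sum T \<phi> n x \<le> max_ergodic_sum T \<phi> n x"
proof (induction n arbitrary: x)
  case (Suc n)
  show ?case using Suc[of "T x"] by (auto simp: ergodic_sum_Suc)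
qed (simp add: ergodic_sum_def)

lemma max_ergodic_sum_bound:
  assumes "\<And>x. \<bar>\<phi> x\<bar> \<le> K"
  shows "max_ergodic_sum T \<phi> n x \<le> n * K"
proof (induction n arbitrary: x)
  case (Suc n)
  have "0 \<le> K" using assms[of x] by linarith
  then show ?case using Suc[of "T x"] assms[of x] by (auto simp: algebra_simps)
qed simp

locale measure_preserving = prob_space M for M :: "'a measure" +
  fixes T :: "'a \<Rightarrow> 'a"
  assumes T_measurable [measurable]: "T \<in> measurable M M"
    and T_preserves: "\<And>A. A \<in> sets M \<Longrightarrow> emeasure M (T -` A \<inter> space M) = emeasure M A"
begin

lemma distr_T: "distr M M T = M"
  by (rule measure_eqI) (auto simp: emeasure_distr T_preserves)

lemma funpow_measurable [measurable]: "(T ^^ n) \<in> measurable M M"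
  by (induction n) (auto simp: id_def)

lemma T_space: "x \<in> space M \<Longrightarrow> T x \<in> space M"
  using T_measurable by (rule measurable_space)

lemma funpow_preserves:
  assumes "A \<in> sets M"
  shows "emeasure M ((T ^^ n) -` A \<inter> space M) = emeasure M A"
proof (induction n)
  case (Suc n)
  have "(T ^^ Suc n) -` A \<inter> space M = T -` ((T ^^ n) -` A \<inter> space M) \<inter> space M"
    using T_space by (auto simp: funpow_swap1)
  also have "emeasure M \<dots> = emeasure M ((T ^^ n) -` A \<inter> space M)"
    using assms by (intro T_preserves measurable_sets[OF funpow_measurable])
  finally show ?case using Suc by (simp only:)
qed (use assms in \<open>simp add: sets.Int_space_eq2\<close>)

lemma max_ergodic_sum_measurable [measurable]:
  assumes [measurable]: "\<phi> \<in> borel_measurable M"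
  shows "max_ergodic_sum T \<phi> n \<in> borel_measurable M"
proof (induction n)
  case (Suc n)
  note [measurable] = Suc
  have "(\<lambda>x. max 0 (\<phi> x + max_ergodic_sum T \<phi> n (T x))) \<in> borel_measurable M" by measurable
  then show ?case by (simp add: max_ergodic_sum.simps(2)[abs_def])
qed (simp add: max_ergodic_sum.simps(1)[abs_def])

lemma ergodic_sum_measurable [measurable]:
  "\<phi> \<in> borel_measurable M \<Longrightarrow> ergodic_sum T \<phi> n \<in> borel_measurable M"
  unfolding ergodic_sum_def[abs_def]
  by (intro borel_measurable_sum measurable_compose[OF funpow_measurable])

text \<open>Garsia's argument: where the running maximum at \<open>x\<close> is positive, it exceeds
  its value at \<open>T x\<close> by at most \<open>\<phi> x\<close>; elsewhere it is 0 and does not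
  exceed it. The integral of the difference vanishes by invariance.\<close>

theorem maximal_ergodic:
  assumes [measurable]: "\<phi> \<in> borel_measurable M" and bound: "\<And>x. \<bar>\<phi> x\<bar> \<le> K"
    and pos: "AE x in M. \<exists>n. ergodic_sum T \<phi> n x > 0"
  shows "0 \<le> (\<integral>x. \<phi> x \<partial>M)"
proof -
  let ?m = "max_ergodic_sum T \<phi>"
  let ?E = "\<lambda>n. {x\<in>space M. 0 < ?m (Suc n) x}"
  have int: "integrable M (?m n)" for n
    using max_ergodic_sum_bound[where T=T and n=n and K=K, OF bound] max_ergodic_sum_nonneg[of T \<phi> n]
    by (intro integrable_const_bound[of _ "n * K"]) auto
  have ge: "0 \<le> (\<integral>x. indicator (?E n) x * \<phi> x \<partial>M)" for n
  proof -
    have "(\<integral>x. ?m (Suc n) (T x) \<partial>M) = (\<integral>x. ?m (Suc n) x \<partial>distr M M T)"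
      by (rule integral_distr[symmetric]) measurable
    then have eq: "(\<integral>x. ?m (Suc n) (T x) \<partial>M) = (\<integral>x. ?m (Suc n) x \<partial>M)" by (simp only: distr_T)
    have intT: "integrable M (\<lambda>x. ?m (Suc n) (T x))"
      using integrable_distr[of T M M "?m (Suc n)"] int[of "Suc n"] by (simp add: distr_T)
    have "0 = (\<integral>x. ?m (Suc n) x - ?m (Suc n) (T x) \<partial>M)"
      using eq int intT by (simp del: max_ergodic_sum.simps)
    also have "\<dots> \<le> (\<integral>x. indicator (?E n) x * \<phi> x \<partial>M)"
    proof (rule integral_mono)
      show "integrable M (\<lambda>x. ?m (Suc n) x - ?m (Suc n) (T x))" using int intT by (rule Bochner_Integration.integrable_diff)
      show "integrable M (\<lambda>x. indicator (?E n) x * \<phi> x)"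
      proof (intro integrable_const_bound[of _ K] AE_I2)
        show "norm (indicator (?E n) x * \<phi> x) \<le> K" for x
          using bound[of x] by (auto simp: indicator_def)
      qed measurable
      fix x assume "x \<in> space M"
      then show "?m (Suc n) x - ?m (Suc n) (T x) \<le> indicator (?E n) x * \<phi> x"
        using max_ergodic_sum_Suc_mono[of T \<phi> n "T x"] max_ergodic_sum_nonneg[of T \<phi> "Suc n" "T x"]
        by (auto simp: indicator_def)
    qed
    finally show ?thesis .
  qed
  \<comment> \<open>By \<open>pos\<close> almost every point lies in \<open>?E n\<close> for all
    large \<open>n\<close>, so the localised inequalities pass to the limit.\<close>
  have "(\<lambda>n. \<integral>x. indicator (?E n) x * \<phi> x \<partial>M) \<longlonglongrightarrow> (\<integral>x. \<phi> x \<partial>M)"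
  proof (rule integral_dominated_convergence[where w="\<lambda>_. K"])
    show "AE x in M. (\<lambda>n. indicator (?E n) x * \<phi> x) \<longlonglongrightarrow> \<phi> x"
      using pos AE_space
    proof eventually_elim
      case (elim x)
      then obtain k where "ergodic_sum T \<phi> k x > 0" by blast
      then have "0 < ?m k x" using ergodic_sum_le_max[of T \<phi> k x] by linarith
      then have "0 < ?m (Suc n) x" if "n \<ge> k" for n
        using max_ergodic_sum_mono[of k "Suc n" T \<phi> x] that by linarith
      then have "\<forall>\<^sub>F n in sequentially. indicator (?E n) x * \<phi> x = \<phi> x"
        using elim(2) by (intro eventually_sequentiallyI[of k]) (simp add: indicator_def del: max_ergodic_sum.simps)
      then show ?case by (rule tendsto_eventually)
    qed
    show "AE x in M. norm (indicator (?E n) x * \<phi> x) \<le> K" for n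
      using bound by (intro AE_I2) (auto simp: indicator_def intro: order_trans[OF abs_ge_zero])
  qed auto
  then show ?thesis using ge by (intro LIMSEQ_le_const) auto
qed

end

section \<open>Birkhoff's theorem for bounded functions\<close>

locale ergodic_system = measure_preserving +
  assumes ergodic: "\<And>A. A \<in> sets M \<Longrightarrow> T -` A \<inter> space M = A \<Longrightarrow> emeasure M A = 0 \<or> emeasure M A = 1"
begin

text \<open>The limsup is invariant, so it exceeds \<open>c\<close> on a set of measure 0 or 1;
  measure 1 would give \<open>\<phi> - c\<close> a positive Birkhoff sum almost everywhere, and the
  maximal theorem would make the integral of \<open>\<phi>\<close> at least
  \<open>c\<close>.\<close>

lemma AE_limsup_ergodic_average_le:
  assumes [measurable]: "\<phi> \<in> borel_measurable M" and bound: "\<And>x. \<bar>\<phi> x\<bar> \<le> K"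
    and c: "(\<integral>x. \<phi> x \<partial>M) < c"
  shows "AE x in M. limsup (\<lambda>n. ereal (ergodic_sum T \<phi> n x / n)) \<le> c"
proof -
  define L where "L x = limsup (\<lambda>n. ereal (ergodic_sum T \<phi> n x / n))" for x
  have [measurable]: "L \<in> borel_measurable M" unfolding L_def by measurable
  \<comment> \<open>The bound on \<open>\<phi>\<close> at every point makes \<open>L\<close>
    invariant everywhere, so that \<open>A\<close> below is exactly invariant, as
    \<open>ergodic\<close> demands.\<close>
  have LT: "L (T x) = L x" for x
  proof -
    have eq: "ereal (ergodic_sum T \<phi> n (T x) / n) =
        ereal ((\<phi> ((T ^^ n) x) - \<phi> x) / n) + ereal (ergodic_sum T \<phi> n x / n)" for n
    proof -
      have "ergodic_sum T \<phi> (Suc n) x = ergodic_sum T \<phi> n x + \<phi> ((T ^^ n) x)"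
        by (simp add: ergodic_sum_def)
      then have "ergodic_sum T \<phi> n (T x) = \<phi> ((T ^^ n) x) - \<phi> x + ergodic_sum T \<phi> n x"
        by (simp add: ergodic_sum_Suc)
      then show ?thesis by (simp add: add_divide_distrib)
    qed
    have "(\<lambda>n. (\<phi> ((T ^^ n) x) - \<phi> x) / n) \<longlonglongrightarrow> 0"
    proof (rule Lim_null_comparison[OF _ lim_const_over_n[of "2 * K"]], intro always_eventually allI)
      fix n
      have "\<bar>\<phi> ((T ^^ n) x) - \<phi> x\<bar> \<le> 2 * K" using bound[of "(T ^^ n) x"] bound[of x] by linarith
      then show "norm ((\<phi> ((T ^^ n) x) - \<phi> x) / n) \<le> 2 * K / n" by (simp add: divide_right_mono)
    qed
    then have "(\<lambda>n. ereal ((\<phi> ((T ^^ n) x) - \<phi> x) / n)) \<longlonglongrightarrow> ereal 0" by simp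
    from ereal_limsup_lim_add[OF this, of "\<lambda>n. ereal (ergodic_sum T \<phi> n x / n)"]
    show ?thesis by (simp add: L_def eq del: plus_ereal.simps)
  qed
  define A where "A = {x\<in>space M. L x > c}"
  have A[measurable]: "A \<in> sets M" unfolding A_def by measurable
  have "T -` A \<inter> space M = A" using T_space by (auto simp: A_def LT)
  with ergodic[OF A] have "emeasure M A = 0 \<or> emeasure M A = 1" by blast
  moreover have "emeasure M A \<noteq> 1"
  proof
    assume "emeasure M A = 1"
    then have "AE x in M. x \<in> A" by (subst prob_space.AE_in_set_eq_1 [OF prob_space_axioms]) (auto simp: emeasure_eq_measure)
    then have "AE x in M. \<exists>n. ergodic_sum T (\<lambda>x. \<phi> x - c) n x > 0"
    proof eventually_elim
      case (elim x)
      then have "c < limsup (\<lambda>n. ereal (ergodic_sum T \<phi> n x / n))" by (simp add: A_def L_def)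
      \<comment> \<open>At \<open>n = 0\<close> the average is 0 by convention and could exceed a
        negative \<open>c\<close> without a positive sum, hence \<open>n \<ge> 1\<close>.\<close>
      then have "\<exists>n\<ge>1. ereal c < ereal (ergodic_sum T \<phi> n x / n)"
        using less_INF_D[of "ereal c" "\<lambda>P. SUP n\<in>{n. P n}. ereal (ergodic_sum T \<phi> n x / n)" _ "\<lambda>n. n \<ge> 1"]
        by (auto simp: Limsup_def less_SUP_iff eventually_ge_at_top)
      then obtain n :: nat where n: "n \<ge> 1" "c < ergodic_sum T \<phi> n x / n" by auto
      then have "ergodic_sum T (\<lambda>x. \<phi> x - c) n x > 0"
        by (simp add: ergodic_sum_def sum_subtractf field_simps)
      then show ?case by blast
    qed
    moreover have "\<bar>\<phi> x - c\<bar> \<le> K + \<bar>c\<bar>" for x using bound[of x] by linarith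
    ultimately have "0 \<le> (\<integral>x. \<phi> x - c \<partial>M)" by (intro maximal_ergodic) auto
    moreover have "integrable M \<phi>" using bound by (intro integrable_const_bound[of _ K]) auto
    ultimately show False using c by (simp add: prob_space)
  qed
  ultimately have "AE x in M. x \<notin> A" by (intro AE_not_in) auto
  then show ?thesis using AE_space by eventually_elim (auto simp: A_def L_def not_less)
qed

text \<open>Letting \<open>c\<close> decrease to the integral bounds the limsup; the same bound for
  \<open>- \<phi>\<close> bounds the liminf from below.\<close>

theorem AE_ergodic_average_tendsto:
  assumes [measurable]: "\<phi> \<in> borel_measurable M" and bound: "\<And>x. \<bar>\<phi> x\<bar> \<le> K"
  shows "AE x in M. (\<lambda>n. ergodic_sum T \<phi> n x / n) \<longlonglongrightarrow> (\<integral>x. \<phi> x \<partial>M)"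
proof -
  have le: "AE x in M. limsup (\<lambda>n. ereal (ergodic_sum T \<psi> n x / n)) \<le> ereal (\<integral>x. \<psi> x \<partial>M)"
    if [measurable]: "\<psi> \<in> borel_measurable M" and "\<And>x. \<bar>\<psi> x\<bar> \<le> K" for \<psi>
  proof -
    have "AE x in M. \<forall>k. limsup (\<lambda>n. ereal (ergodic_sum T \<psi> n x / n)) \<le> ereal ((\<integral>x. \<psi> x \<partial>M) + 1 / real (Suc k))"
      unfolding AE_all_countable using that by (intro allI AE_limsup_ergodic_average_le[of _ K]) auto
    then show ?thesis
    proof eventually_elim
      case (elim x)
      have "(\<lambda>k. ereal ((\<integral>x. \<psi> x \<partial>M) + 1 / real (Suc k))) \<longlonglongrightarrow> ereal ((\<integral>x. \<psi> x \<partial>M) + 0)"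
        by (intro tendsto_intros LIMSEQ_Suc[OF lim_const_over_n])
      from LIMSEQ_le_const[OF this] elim show ?case by simp
    qed
  qed
  have "AE x in M. limsup (\<lambda>n. ereal (ergodic_sum T (\<lambda>x. - \<phi> x) n x / n)) \<le> ereal (\<integral>x. - \<phi> x \<partial>M)"
    using bound by (intro le) auto
  with le[OF assms] show ?thesis
  proof eventually_elim
    case (elim x)
    let ?a = "\<lambda>n. ereal (ergodic_sum T \<phi> n x / n)"
    have "(\<lambda>n. ereal (ergodic_sum T (\<lambda>x. - \<phi> x) n x / n)) = (\<lambda>n. - ?a n)"
      by (simp add: ergodic_sum_def sum_negf)
    then have "limsup (\<lambda>n. - ?a n) \<le> - ereal (\<integral>x. \<phi> x \<partial>M)" using elim(2) by simp
    then have "ereal (\<integral>x. \<phi> x \<partial>M) \<le> liminf ?a"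
      by (simp add: ereal_Limsup_uminus ereal_minus_le_minus del: uminus_ereal.simps)
    moreover have "liminf ?a \<le> limsup ?a" by (rule Liminf_le_Limsup) simp
    ultimately have "?a \<longlonglongrightarrow> ereal (\<integral>x. \<phi> x \<partial>M)"
      using elim(1) by (intro Liminf_eq_Limsup) auto
    then show ?case by simp
  qed
qed

end

section \<open>Ergodic measures and CO-measures\<close>

lemma space_unit: "sets M = sets unit_borel \<Longrightarrow> space M = {0..1}"
  by (drule sets_eq_imp_space_eq) (simp add: space_restrict_space)

lemma (in interval_map) measurable_unit_borel:
  assumes "sets M = sets unit_borel"
  shows "f \<in> measurable M M"
proof -
  have "f \<in> borel_measurable unit_borel" by (rule borel_measurable_continuous_on_restrict[OF cont])
  then have "f \<in> measurable unit_borel unit_borel"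
    by (rule measurable_restrict_space2[rotated]) (use maps in \<open>simp add: space_restrict_space\<close>)
  then show ?thesis using measurable_cong_sets[OF assms assms] by simp
qed

lemma (in interval_map) measure_preserving_invariant:
  assumes "M \<in> invariant_measures f"
  shows "measure_preserving M f"
proof -
  from assms have M: "sets M = sets unit_borel" "prob_space M"
    "\<And>A. A \<in> sets M \<Longrightarrow> emeasure M (f -` A \<inter> space M) = emeasure M A"
    by (auto simp: invariant_measures_def)
  interpret prob_space M by fact
  show ?thesis by unfold_locales (use M measurable_unit_borel in auto)
qed

lemma (in interval_map) ergodic_system_ergodic:
  assumes "M \<in> ergodic_measures f"
  shows "ergodic_system M f"
proof -
  have "M \<in> invariant_measures f" using assms by (simp add: ergodic_measures_def)
  then interpret measure_preserving M f by (rule measure_preserving_invariant)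
  show ?thesis by unfold_locales (use assms in \<open>auto simp: ergodic_measures_def\<close>)
qed

lemma unit_borel_sets:
  assumes "sets M = sets unit_borel" "A \<in> sets borel" "A \<subseteq> {0..1}"
  shows "A \<in> sets M"
  using assms by (auto simp: sets_restrict_space_iff)

text \<open>The complement of the support is a union of relatively open null sets, and Lindelof's
  theorem leaves countably many of them.\<close>

lemma null_complement_support:
  assumes sM: "sets M = sets unit_borel"
  shows "AE x in M. x \<in> measure_support M"
proof -
  define \<U> where "\<U> = {U :: real set. open U \<and> emeasure M (U \<inter> space M) = 0}"
  obtain \<V> where \<V>: "\<V> \<subseteq> \<U>" "countable \<V>" "\<Union>\<V> = \<Union>\<U>"
    using Lindelof[of \<U>] by (auto simp: \<U>_def)
  have "AE x in M. x \<notin> U" if "U \<in> \<V>" for U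
  proof -
    have "U \<in> \<U>" using that \<V> by blast
    moreover have "U \<inter> space M \<in> sets M" 
      using \<open>U \<in> \<U>\<close> sM by (auto simp: \<U>_def space_unit[OF sM] sets_restrict_space_iff)
    ultimately have "AE x in M. x \<notin> U \<inter> space M" by (intro AE_not_in) (auto simp: \<U>_def)
    then show ?thesis using AE_space by eventually_elim auto
  qed
  then have "AE x in M. \<forall>U\<in>\<V>. x \<notin> U" using \<V>(2) by (simp add: AE_ball_countable)
  then show ?thesis using AE_space
  proof eventually_elim
    case (elim x)
    then have "x \<notin> \<Union>\<U>" using \<V>(3) by blast
    with elim show ?case by (auto simp: measure_support_def \<U>_def zero_less_iff_neq_zero)
  qed
qed

section \<open>CO-measures: ergodicity, atoms and orbit measures\<close>

context interval_map
begin

text \<open>An invariant set contains all or none of the orbit that carries the measure.\<close>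

lemma CO_subset_ergodic: "CO_measures f \<subseteq> ergodic_measures f"
proof
  fix M assume "M \<in> CO_measures f"
  then have inv: "M \<in> invariant_measures f" and per: "periodic_orbit f (measure_support M)"
    by (auto simp: CO_measures_def)
  have sM: "sets M = sets unit_borel" using inv by (simp add: invariant_measures_def)
  interpret measure_preserving M f using inv by (rule measure_preserving_invariant)
  obtain x n where x: "x \<in> {0..1}" "n > 0" "(f ^^ n) x = x" "measure_support M = range (\<lambda>k. (f ^^ k) x)"
    using per by (auto simp: periodic_orbit_def)
  have "emeasure M A = 0 \<or> emeasure M A = 1" if A: "A \<in> sets M" "f -` A \<inter> space M = A" for A
  proof -
    have "f u \<in> A \<longleftrightarrow> u \<in> A" if "u \<in> {0..1}" for u
      using A(2) that space_unit[OF sM] by blast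
    then have "(f ^^ k) x \<in> A \<longleftrightarrow> x \<in> A" for k
      using funpow_mem[OF x(1)] by (induction k) auto
    then have supp: "u \<in> A \<longleftrightarrow> x \<in> A" if "u \<in> measure_support M" for u
      using that x(4) by auto
    show ?thesis
    proof (cases "x \<in> A")
      case True
      then have "AE u in M. u \<in> A"
        using supp by (intro eventually_mono[OF null_complement_support[OF sM]]) blast
      then show ?thesis using A(1) by (simp add: emeasure_eq_1_AE)
    next
      case False
      then have "AE u in M. u \<notin> A"
        using supp by (intro eventually_mono[OF null_complement_support[OF sM]]) blast
      then show ?thesis using A(1) by (simp add: AE_iff_measurable[OF _ refl] AE_iff_null_sets null_setsD1)
    qed
  qed
  then show "M \<in> ergodic_measures f" using inv by (simp add: ergodic_measures_def)
qed

text \<open>Point masses do not decrease along the orbit of an atom, so total mass 1 forces the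
  orbit into a cycle; ergodicity then gives this cycle full mass.\<close>

lemma ergodic_atom_CO:
  assumes M: "M \<in> ergodic_measures f" and c: "c \<in> {0..1}" and atom: "measure M {c} > 0"
  shows "M \<in> CO_measures f"
proof -
  have inv: "M \<in> invariant_measures f" using M by (simp add: ergodic_measures_def)
  have sM: "sets M = sets unit_borel" using inv by (simp add: invariant_measures_def)
  note spM = space_unit[OF sM]
  interpret ergodic_system M f using M by (rule ergodic_system_ergodic)
  have setI: "A \<in> sets M" if "A \<in> sets borel" "A \<subseteq> {0..1}" for A
    using unit_borel_sets[OF sM that] .
  have step: "measure M {u} \<le> measure M {f u}" if "u \<in> {0..1}" for u
  proof -
    have "f u \<in> {0..1}" using that maps by blast
    then have "measure M {f u} = measure M (f -` {f u} \<inter> space M)"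
      using T_preserves[of "{f u}"] setI by (simp add: measure_def)
    moreover have "measure M {u} \<le> measure M (f -` {f u} \<inter> space M)"
      using that \<open>f u \<in> {0..1}\<close> spM setI by (intro finite_measure_mono measurable_sets[OF T_measurable]) auto
    ultimately show ?thesis by simp
  qed
  have mono: "measure M {u} \<le> measure M {(f ^^ k) u}" if "u \<in> {0..1}" for u k
  proof (induction k)
    case (Suc k)
    then show ?case using step[OF funpow_mem[OF that, of k]] by simp
  qed simp
  have "\<not> inj (\<lambda>k. (f ^^ k) c)"
  proof
    assume inj: "inj (\<lambda>k. (f ^^ k) c)"
    obtain N :: nat where N: "1 < real N * measure M {c}"
      using atom reals_Archimedean3[of "measure M {c}"] by blast
    let ?P = "(\<lambda>k. (f ^^ k) c) ` {..<N}"
    have fin: "finite ?P" by simp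
    have "real N * measure M {c} = (\<Sum>k<N. measure M {c})" by simp
    also have "\<dots> \<le> (\<Sum>k<N. measure M {(f ^^ k) c})" by (intro sum_mono mono c)
    also have "\<dots> = (\<Sum>u\<in>?P. measure M {u})"
      using inj by (subst sum.reindex) (auto intro: inj_on_subset)
    also have "\<dots> = measure M ?P"
      using funpow_mem[OF c] setI by (intro finite_measure_eq_sum_singleton[symmetric]) auto
    also have "\<dots> \<le> 1" by simp
    finally show False using N by simp
  qed
  then obtain i j where ij: "i < j" "(f ^^ i) c = (f ^^ j) c"
    using linorder_injI[of "\<lambda>k. (f ^^ k) c"] by blast
  \<comment> \<open>\<open>c\<close> is so far only known to be preperiodic; \<open>q\<close> lies
    on the cycle that it reaches.\<close>
  define q n where "q = (f ^^ i) c" and "n = j - i"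
  have q: "q \<in> {0..1}" unfolding q_def by (rule funpow_mem[OF c])
  have "(f ^^ n) q = (f ^^ (n + i)) c" by (simp add: q_def funpow_add)
  with ij have n: "n > 0" "(f ^^ n) q = q" by (simp_all add: n_def q_def)
  have qpos: "measure M {(f ^^ k) q} > 0" for k
    using mono[OF c, of i] mono[OF q, of k] atom by (simp add: q_def)
  define P where "P = range (\<lambda>k. (f ^^ k) q)"
  have P01: "P \<subseteq> {0..1}" unfolding P_def using funpow_mem[OF q] by blast
  have "P = (\<lambda>k. (f ^^ k) q) ` {..<n}"
  proof -
    have "(f ^^ k) q = (f ^^ (k mod n)) q" for k
      using funpow_mod_eq[OF n(2)] by simp
    then show ?thesis using n(1) unfolding P_def by (auto intro!: image_eqI[of _ _ "_ mod n"])
  qed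
  then have finP: "finite P" by simp
  have fP: "f u \<in> P" if u: "u \<in> P" for u
  proof -
    obtain k where "u = (f ^^ k) q" using u unfolding P_def by blast
    then have "f u = (f ^^ Suc k) q" by simp
    then show ?thesis unfolding P_def by blast
  qed
  have PM: "P \<in> sets M" using P01 finP by (intro setI) (auto intro: borel_closed finite_imp_closed)
  \<comment> \<open>\<open>P\<close> need not equal its preimage, so ergodicity is applied to the
    union \<open>A\<close> of the iterated preimages, which increase and all have the mass of
    \<open>P\<close>.\<close>
  define B where "B k = (f ^^ k) -` P \<inter> space M" for k
  have BM: "B k \<in> sets M" for k unfolding B_def by (rule measurable_sets[OF funpow_measurable PM])
  have Binc: "incseq B" by (rule incseq_SucI) (auto simp: B_def fP)
  define A where "A = (\<Union>k. B k)"
  have "emeasure M A = (SUP k. emeasure M (B k))"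
    unfolding A_def using BM Binc by (intro SUP_emeasure_incseq[symmetric]) auto
  also have "\<dots> = emeasure M P" using funpow_preserves[OF PM] by (simp add: B_def)
  finally have AP: "emeasure M A = emeasure M P" .
  have "f -` A \<inter> space M = A"
  proof (intro set_eqI iffI)
    fix u assume "u \<in> f -` A \<inter> space M"
    then obtain k where "(f ^^ k) (f u) \<in> P" "u \<in> space M" by (auto simp: A_def B_def)
    then have "u \<in> B (Suc k)" by (simp add: B_def funpow_swap1)
    then show "u \<in> A" by (auto simp: A_def)
  next
    fix u assume "u \<in> A"
    then obtain k where "u \<in> B k" by (auto simp: A_def)
    then have "u \<in> space M" "(f ^^ k) (f u) \<in> P" using fP by (auto simp: B_def funpow_swap1[symmetric])
    then show "u \<in> f -` A \<inter> space M" using T_space by (auto simp: A_def B_def)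
  qed
  then have "emeasure M A = 0 \<or> emeasure M A = 1" using BM by (intro ergodic) (auto simp: A_def)
  moreover have "measure M {q} \<le> measure M P"
    using PM by (intro finite_measure_mono) (auto simp: P_def intro: image_eqI[of _ _ 0])
  ultimately have "emeasure M P = 1" using qpos[of 0] AP by (auto simp: emeasure_eq_measure)
  then have prP: "emeasure M (space M - P) = 0"
    using PM by (simp add: emeasure_compl emeasure_space_1)
  have "measure_support M = P"
  proof (intro set_eqI iffI)
    fix u assume u: "u \<in> measure_support M"
    show "u \<in> P"
    proof (rule ccontr)
      assume "u \<notin> P"
      moreover have "open (- P)" using finP by (simp add: finite_imp_closed open_Compl)
      ultimately have "emeasure M (- P \<inter> space M) > 0" using u unfolding measure_support_def by blast
      moreover have "- P \<inter> space M = space M - P" by blast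
      ultimately show False using prP by simp
    qed
  next
    fix u assume "u \<in> P"
    then obtain k where k: "u = (f ^^ k) q" by (auto simp: P_def)
    have "0 < emeasure M (U \<inter> space M)" if "open U" "u \<in> U" for U
    proof -
      have "0 < emeasure M {u}" using qpos[of k] k by (simp add: emeasure_eq_measure)
      also have "\<dots> \<le> emeasure M (U \<inter> space M)"
        using that \<open>u \<in> P\<close> P01 spM by (intro emeasure_mono setI) auto
      finally show ?thesis .
    qed
    then show "u \<in> measure_support M" using \<open>u \<in> P\<close> P01 spM by (auto simp: measure_support_def)
  qed
  then have "periodic_orbit f (measure_support M)"
    unfolding periodic_orbit_def P_def using q n by blast
  then show ?thesis using inv by (simp add: CO_measures_def)
qed

text \<open>The weight is uniform on times rather than on points, so \<open>m\<close> may be any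
  period of \<open>z\<close>, not only the least.\<close>

definition orbit_measure :: "real \<Rightarrow> nat \<Rightarrow> real measure" where
  "orbit_measure z m = distr (uniform_count_measure {..<m}) unit_borel (\<lambda>i. (f ^^ i) z)"

lemma emeasure_orbit_measure:
  assumes "z \<in> {0..1}" "m > 0" "A \<in> sets unit_borel"
  shows "emeasure (orbit_measure z m) A = card {i. i < m \<and> (f ^^ i) z \<in> A} / m"
proof -
  have "(\<lambda>i. (f ^^ i) z) \<in> measurable (uniform_count_measure {..<m}) unit_borel"
    using funpow_mem[OF assms(1)]
    by (simp add: measurable_def space_uniform_count_measure sets_uniform_count_measure space_restrict_space)
  then have "emeasure (orbit_measure z m) A =
      emeasure (uniform_count_measure {..<m}) ((\<lambda>i. (f ^^ i) z) -` A \<inter> {..<m})"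
    unfolding orbit_measure_def using assms(3)
    by (simp add: emeasure_distr space_uniform_count_measure)
  also have "(\<lambda>i. (f ^^ i) z) -` A \<inter> {..<m} = {i. i < m \<and> (f ^^ i) z \<in> A}" by auto
  finally show ?thesis using assms(2)
    by (subst (asm) emeasure_uniform_count_measure) (auto simp: ennreal_of_nat_eq_real_of_nat divide_ennreal)
qed

lemma orbit_measure_CO:
  assumes z: "z \<in> {0..1}" and m: "m > 0" "(f ^^ m) z = z"
  shows "orbit_measure z m \<in> CO_measures f"
proof -
  let ?N = "orbit_measure z m"
  have sN: "sets ?N = sets unit_borel" by (simp add: orbit_measure_def)
  note spN = space_unit[OF sN]
  note em = emeasure_orbit_measure[OF z m(1)]
  have "prob_space ?N"
    using em[of "{0..1}"] m(1) funpow_mem[OF z] spN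
    by (intro prob_spaceI) (simp add: sets_restrict_space_iff)
  moreover have "emeasure ?N (f -` A \<inter> space ?N) = emeasure ?N A" if A: "A \<in> sets ?N" for A
  proof -
    let ?C = "{i. i < m \<and> (f ^^ i) z \<in> A}" and ?D = "{i. i < m \<and> (f ^^ i) z \<in> f -` A \<inter> space ?N}"
    have D: "?D = {i. i < m \<and> (f ^^ Suc i) z \<in> A}" using funpow_mem[OF z] spN by auto
    \<comment> \<open>Moving the window of times by one drops \<open>z\<close> and adds
      \<open>(f ^^ m) z\<close>, which is \<open>z\<close> again.\<close>
    have "(\<Sum>i<m. of_bool ((f ^^ i) z \<in> A)) + of_bool ((f ^^ m) z \<in> A) =
          of_bool (z \<in> A) + (\<Sum>i<m. of_bool ((f ^^ Suc i) z \<in> A) :: nat)"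
      using sum.lessThan_Suc_shift[of "\<lambda>i. of_bool ((f ^^ i) z \<in> A) :: nat" m]
        sum.lessThan_Suc[of "\<lambda>i. of_bool ((f ^^ i) z \<in> A) :: nat" m] by simp
    then have "(\<Sum>i<m. of_bool ((f ^^ i) z \<in> A)) = (\<Sum>i<m. of_bool ((f ^^ Suc i) z \<in> A) :: nat)"
      using m(2) by simp
    then have "card ?C = card {i. i < m \<and> (f ^^ Suc i) z \<in> A}"
      by (simp add: sum_of_bool_eq Int_def del: funpow.simps)
    moreover have "f -` A \<inter> space ?N \<in> sets unit_borel"
      using measurable_sets[OF measurable_unit_borel[OF sN] A] sN by simp
    ultimately show ?thesis using A em D sN by simp
  qed
  ultimately have inv: "?N \<in> invariant_measures f" using sN by (simp add: invariant_measures_def)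
  have "measure_support ?N = range (\<lambda>k. (f ^^ k) z)"
  proof (intro set_eqI iffI)
    fix u assume u: "u \<in> measure_support ?N"
    show "u \<in> range (\<lambda>k. (f ^^ k) z)"
    proof (rule ccontr)
      assume u': "u \<notin> range (\<lambda>k. (f ^^ k) z)"
      let ?P = "(\<lambda>k. (f ^^ k) z) ` {..<m}"
      have "open (- ?P)" by (intro open_Compl finite_imp_closed) simp
      moreover have "u \<in> - ?P" using u' by blast
      ultimately have "emeasure ?N (- ?P \<inter> space ?N) > 0" using u unfolding measure_support_def by blast
      moreover have "- ?P \<inter> space ?N \<in> sets unit_borel"
        using \<open>open (- ?P)\<close> spN by (auto simp: sets_restrict_space_iff)
      moreover have "{i. i < m \<and> (f ^^ i) z \<in> - ?P \<inter> space ?N} = {}" by blast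
      ultimately show False using em[of "- ?P \<inter> space ?N"] by (simp only: card.empty) simp
    qed
  next
    fix u assume "u \<in> range (\<lambda>k. (f ^^ k) z)"
    then obtain k where "u = (f ^^ k) z" by blast
    then have k: "u = (f ^^ (k mod m)) z" "k mod m < m" using funpow_mod_eq[OF m(2), of k] m(1) by auto
    then have u: "u \<in> {0..1}" using funpow_mem[OF z] by blast
    have "0 < emeasure ?N (U \<inter> space ?N)" if "open U" "u \<in> U" for U
    proof -
      have "k mod m \<in> {i. i < m \<and> (f ^^ i) z \<in> U \<inter> space ?N}" using k that u spN by auto
      then have "0 < card {i. i < m \<and> (f ^^ i) z \<in> U \<inter> space ?N}" by (intro card_gt_0_iff[THEN iffD2]) auto
      moreover have "U \<inter> space ?N \<in> sets unit_borel" using that spN by (auto simp: sets_restrict_space_iff)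
      ultimately show ?thesis using em m(1) by simp
    qed
    then show "u \<in> measure_support ?N" using u spN by (simp add: measure_support_def)
  qed
  then have "periodic_orbit f (measure_support ?N)"
    unfolding periodic_orbit_def using z m by blast
  with inv show ?thesis by (simp add: CO_measures_def)
qed

end

section \<open>Distribution functions, generic points and weak convergence\<close>

definition unit_cdf :: "real measure \<Rightarrow> real \<Rightarrow> real" where
  "unit_cdf M = cdf (distr M borel (\<lambda>x. x))"

lemma borel_measurable_unit:
  assumes "sets M = sets unit_borel"
  shows "(\<lambda>x. x) \<in> borel_measurable M"
  using measurable_restrict_space1[of "\<lambda>x. x" borel borel "{0..1}"] measurable_cong_sets[OF assms refl, of borel] by auto

lemma real_distribution_unit:
  assumes "sets M = sets unit_borel" "prob_space M"
  shows "real_distribution (distr M borel (\<lambda>x. x))"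
  using prob_space.real_distribution_distr[OF assms(2) borel_measurable_unit[OF assms(1)]] .

lemma measure_distr_unit:
  assumes "sets M = sets unit_borel" "A \<in> sets borel"
  shows "measure (distr M borel (\<lambda>x. x)) A = measure M (A \<inter> {0..1})"
  using measure_distr[OF borel_measurable_unit[OF assms(1)] assms(2)] by (simp add: space_unit[OF assms(1)])

lemma unit_cdf_eq:
  assumes "sets M = sets unit_borel"
  shows "unit_cdf M t = measure M ({..t} \<inter> {0..1})"
  unfolding unit_cdf_def cdf_def by (simp add: measure_distr_unit assms)

lemma continuous_on_unit_cdf:
  assumes sM: "sets M = sets unit_borel" and "prob_space M" and "\<And>x. x \<in> {0..1} \<Longrightarrow> measure M {x} = 0"
  shows "continuous_on UNIV (unit_cdf M)"
proof -
  interpret real_distribution "distr M borel (\<lambda>x. x)" by (rule real_distribution_unit) fact+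
  have "measure (distr M borel (\<lambda>x. x)) {x} = 0" for x
    using assms(3)[of x] by (cases "x \<in> {0..1}") (auto simp: measure_distr_unit[OF sM])
  then show ?thesis
    unfolding unit_cdf_def by (auto intro!: continuous_at_imp_continuous_on simp: isCont_cdf)
qed

lemma unit_cdf_less_support:
  assumes sM: "sets M = sets unit_borel" and pM: "prob_space M" and x: "x \<in> measure_support M" and d: "d > 0"
  shows "unit_cdf M (x - d) < unit_cdf M (x + d)"
proof -
  interpret prob_space M by fact
  let ?U = "{x - d<..<x + d}"
  have UM: "A \<inter> {0..1} \<in> sets M" if "A \<in> sets borel" for A
    using that by (intro unit_borel_sets[OF sM]) auto
  have "0 < emeasure M (?U \<inter> space M)" using x d by (simp add: measure_support_def)
  then have "0 < measure M (?U \<inter> {0..1})" by (simp add: emeasure_eq_measure space_unit[OF sM])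
  moreover have "measure M ({..x - d} \<inter> {0..1}) + measure M (?U \<inter> {0..1}) =
      measure M ({..x - d} \<inter> {0..1} \<union> ?U \<inter> {0..1})"
    using d by (intro finite_measure_Union[symmetric] UM) auto
  moreover have "\<dots> \<le> measure M ({..x + d} \<inter> {0..1})"
    using d by (intro finite_measure_mono UM) auto
  ultimately show ?thesis by (simp add: unit_cdf_eq[OF sM])
qed

text \<open>Almost sure convergence can be joined over countably many thresholds; monotonicity of
  the empirical functions and continuity of \<open>h\<close> then pass from rational thresholds to
  all.\<close>

lemma genericI_rational:
  assumes hc: "continuous_on UNIV h"
    and lim: "\<And>q. q \<in> \<rat> \<Longrightarrow> (\<lambda>n. orbit_cdf f n x q) \<longlonglongrightarrow> h q"
  shows "generic f h x"
  unfolding generic_def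
proof
  fix t :: real
  have "isCont h t" using hc by (simp add: continuous_on_eq_continuous_at)
  then have ht: "(h \<longlongrightarrow> h t) (nhds t)" by (simp add: continuous_at tendsto_at_iff_tendsto_nhds)
  show "(\<lambda>n. orbit_cdf f n x t) \<longlonglongrightarrow> h t"
  proof (rule order_tendstoI)
    fix a assume "a < h t"
    then obtain d where d: "d > 0" "\<And>u. dist u t < d \<Longrightarrow> a < h u"
      using order_tendstoD(1)[OF ht] by (auto simp: eventually_nhds_metric)
    obtain q where q: "q \<in> \<rat>" "t - d < q" "q < t" using Rats_dense_in_real[of "t - d" t] d(1) by auto
    then have "a < h q" by (intro d(2)) (simp add: dist_real_def)
    then have "\<forall>\<^sub>F n in sequentially. a < orbit_cdf f n x q" using lim[OF q(1)] by (intro order_tendstoD(1))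
    then show "\<forall>\<^sub>F n in sequentially. a < orbit_cdf f n x t"
      by eventually_elim (use orbit_cdf_mono[of q t f _ x] q in \<open>auto intro: less_le_trans\<close>)
  next
    fix a assume "h t < a"
    then obtain d where d: "d > 0" "\<And>u. dist u t < d \<Longrightarrow> h u < a"
      using order_tendstoD(2)[OF ht] by (auto simp: eventually_nhds_metric)
    obtain q where q: "q \<in> \<rat>" "t < q" "q < t + d" using Rats_dense_in_real[of t "t + d"] d(1) by auto
    then have "h q < a" by (intro d(2)) (simp add: dist_real_def)
    then have "\<forall>\<^sub>F n in sequentially. orbit_cdf f n x q < a" using lim[OF q(1)] by (intro order_tendstoD(2))
    then show "\<forall>\<^sub>F n in sequentially. orbit_cdf f n x t < a"
      by eventually_elim (use orbit_cdf_mono[of t q f _ x] q in \<open>auto intro: le_less_trans\<close>)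
  qed
qed

text \<open>Birkhoff's theorem for the indicator of \<open>{..t} \<inter> {0..1}\<close>, whose
  averages are the empirical distribution function at \<open>t\<close>.\<close>

lemma AE_orbit_cdf_tendsto:
  assumes "ergodic_system M T" and sM: "sets M = sets unit_borel"
  shows "AE x in M. (\<lambda>n. orbit_cdf T n x t) \<longlonglongrightarrow> unit_cdf M t"
proof -
  interpret ergodic_system M T by fact
  have A: "{..t} \<inter> {0..1} \<in> sets M" by (intro unit_borel_sets[OF sM]) auto
  have eq: "ergodic_sum T (indicator ({..t} \<inter> {0..1})) n x / n = orbit_cdf T n x t" if "x \<in> space M" for n x
  proof -
    have "(T ^^ i) x \<in> {0..1}" for i
      using measurable_space[OF funpow_measurable that] space_unit[OF sM] by simp
    then have "ergodic_sum T (indicator ({..t} \<inter> {0..1})) n x = (\<Sum>i<n. of_bool ((T ^^ i) x \<le> t))"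
      unfolding ergodic_sum_def by (intro sum.cong) (auto simp: indicator_def)
    also have "\<dots> = card {i. i < n \<and> (T ^^ i) x \<le> t}" by (simp add: sum_of_bool_eq Int_def)
    finally show ?thesis by (simp add: orbit_cdf_def)
  qed
  have int: "(\<integral>x. indicator ({..t} \<inter> {0..1}) x \<partial>M) = unit_cdf M t"
    using A by (simp add: unit_cdf_eq[OF sM] space_unit[OF sM])
  have "AE x in M. (\<lambda>n. ergodic_sum T (indicator ({..t} \<inter> {0..1})) n x / n) \<longlonglongrightarrow>
      (\<integral>x. indicator ({..t} \<inter> {0..1}) x \<partial>M)"
    using A by (intro AE_ergodic_average_tendsto[of _ 1]) (auto simp: indicator_def)
  then show ?thesis using AE_space by eventually_elim (simp only: eq int)
qed

text \<open>After pushing the measures forward to the real line, convergence of distribution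
  functions gives convergence of integrals of bounded continuous functions.\<close>

lemma integral_tendsto_of_unit_cdf:
  fixes N :: "nat \<Rightarrow> real measure"
  assumes M: "sets M = sets unit_borel" "prob_space M"
    and N: "\<And>n. sets (N n) = sets unit_borel" "\<And>n. prob_space (N n)"
    and lim: "\<And>t. (\<lambda>n. unit_cdf (N n) t) \<longlonglongrightarrow> unit_cdf M t"
    and \<phi>: "continuous_on {0..1} (\<phi> :: real \<Rightarrow> real)"
  shows "(\<lambda>n. \<integral>x. \<phi> x \<partial>N n) \<longlonglongrightarrow> (\<integral>x. \<phi> x \<partial>M)"
proof -
  \<comment> \<open>Clamping extends \<open>\<phi>\<close> to a bounded continuous function on the
    line without changing it on the unit interval, where the measures live.\<close>
  define g where "g x = \<phi> (clamp 0 1 x)" for x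
  have gc: "continuous_on UNIV g" unfolding g_def using \<phi> by (intro clamp_continuous_on) (simp add: cbox_interval)
  have "bounded (range g)" unfolding g_def
    using \<phi> by (intro clamp_bounded compact_imp_bounded compact_continuous_image) (auto simp: cbox_interval)
  then obtain B where B: "\<And>x. norm (g x) \<le> B" by (auto simp: bounded_iff)
  have g\<phi>: "g x = \<phi> x" if "x \<in> {0..1}" for x
    using that by (simp add: g_def clamp_cancel_cbox cbox_interval)
  have gb: "g \<in> borel_measurable borel" using gc by (rule borel_measurable_continuous_onI)
  have int: "(\<integral>x. g x \<partial>distr L borel (\<lambda>x. x)) = (\<integral>x. \<phi> x \<partial>L)" if "sets L = sets unit_borel" for L
    using integral_distr[OF borel_measurable_unit[OF that] gb] space_unit[OF that] g\<phi>
    by (auto intro!: Bochner_Integration.integral_cong)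
  have "(\<lambda>n. \<integral>x. g x \<partial>distr (N n) borel (\<lambda>x. x)) \<longlonglongrightarrow> (\<integral>x. g x \<partial>distr M borel (\<lambda>x. x))"
  proof (rule weak_conv_imp_integral_bdd_continuous_conv[of "\<lambda>n. distr (N n) borel (\<lambda>x. x)"])
    show "weak_conv_m (\<lambda>n. distr (N n) borel (\<lambda>x. x)) (distr M borel (\<lambda>x. x))"
      using lim unfolding weak_conv_m_def weak_conv_def by (simp add: unit_cdf_def)
    show "isCont g x" for x using gc by (simp add: continuous_on_eq_continuous_at)
  qed (use M N B real_distribution_unit in auto)
  then show ?thesis by (simp add: int M(1) N(1))
qed

section \<open>Approximation of ergodic measures by CO-measures\<close>

lemma (in interval_map) unit_cdf_orbit_measure:
  assumes "z \<in> {0..1}" "m > 0"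
  shows "unit_cdf (orbit_measure z m) t = orbit_cdf f m z t"
proof -
  have "sets (orbit_measure z m) = sets unit_borel" by (simp add: orbit_measure_def)
  moreover have "{i. i < m \<and> (f ^^ i) z \<in> {..t} \<inter> {0..1}} = {i. i < m \<and> (f ^^ i) z \<le> t}"
    using funpow_mem[OF assms(1)] by auto
  ultimately show ?thesis
    using emeasure_orbit_measure[OF assms, of "{..t} \<inter> {0..1}"]
    by (simp add: unit_cdf_eq orbit_cdf_def measure_def sets_restrict_space_iff)
qed

text \<open>A measure with an atom is itself a CO-measure, so a constant sequence serves. Otherwise
  its distribution function is continuous, and the periodic orbits come from a generic point of its
  support.\<close>

theorem (in interval_map) ergodic_limit_of_CO:
  assumes M: "M \<in> ergodic_measures f"
  shows "\<exists>N. (\<forall>n. N n \<in> CO_measures f) \<and> limitin (weak_topology f) N M sequentially"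
proof (cases "\<exists>c\<in>{0..1}. measure M {c} > 0")
  case True
  then have CO: "M \<in> CO_measures f" using ergodic_atom_CO[OF M] by blast
  then have "M \<in> invariant_measures f" by (simp add: CO_measures_def)
  with CO show ?thesis by (intro exI[of _ "\<lambda>_. M"]) (simp add: limitin_const)
next
  case False
  interpret ergodic_system M f using M by (rule ergodic_system_ergodic)
  have inv: "M \<in> invariant_measures f" using M by (simp add: ergodic_measures_def)
  have sM: "sets M = sets unit_borel" using inv by (simp add: invariant_measures_def)
  have nonatomic: "measure M {c} = 0" if "c \<in> {0..1}" for c
    using False that measure_nonneg[of M "{c}"] by (metis antisym_conv2 not_le)
  define h where "h = unit_cdf M"
  have hc: "continuous_on UNIV h"
    unfolding h_def using sM prob_space_axioms nonatomic by (rule continuous_on_unit_cdf)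
  \<comment> \<open>\<open>h 0\<close> is the mass of the point 0, which vanishes for want of
    atoms.\<close>
  have "{..0} \<inter> {0..1} = {0::real}" "{..1} \<inter> {0..1} = {0..1::real}" by auto
  then have h01: "h 0 = 0" "h 1 = 1"
    using nonatomic[of 0] prob_space space_unit[OF sM] by (simp_all add: h_def unit_cdf_eq[OF sM])
  have "AE x in M. \<forall>q\<in>\<rat>. (\<lambda>n. orbit_cdf f n x q) \<longlonglongrightarrow> h q"
    unfolding h_def using AE_orbit_cdf_tendsto[OF ergodic_system_axioms sM] by (simp add: AE_ball_countable countable_rat)
  then have "AE x in M. generic f h x \<and> x \<in> measure_support M"
    using null_complement_support[OF sM]
    by eventually_elim (auto intro: genericI_rational[OF hc])
  then have "\<exists>x. generic f h x \<and> x \<in> measure_support M"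
    by (rule eventually_happens'[OF ae_filter_bot])
  then obtain x where x: "generic f h x" "x \<in> measure_support M" by blast
  have x01: "x \<in> {0..1}" using x(2) space_unit[OF sM] by (auto simp: measure_support_def)
  have supp: "h (x - d) < h (x + d)" if "d > 0" for d
    unfolding h_def using sM prob_space_axioms x(2) that by (rule unit_cdf_less_support)
  have "\<exists>m>0. \<exists>z\<in>{0..1}. (f ^^ m) z = z \<and> (\<forall>t. \<bar>orbit_cdf f m z t - h t\<bar> \<le> 1 / Suc n)" for n
    using ex_periodic_orbit_cdf_close[OF x(1) hc h01 x01 supp, of "1 / Suc n"] by simp
  then obtain m z where mz: "\<And>n. m n > 0" "\<And>n. z n \<in> {0..1}" "\<And>n. (f ^^ m n) (z n) = z n"
      "\<And>n t. \<bar>orbit_cdf f (m n) (z n) t - h t\<bar> \<le> 1 / Suc n"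
    by metis
  define N where "N n = orbit_measure (z n) (m n)" for n
  have CO: "N n \<in> CO_measures f" for n
    unfolding N_def using mz by (intro orbit_measure_CO)
  then have Ninv: "N n \<in> invariant_measures f" for n by (auto simp: CO_measures_def)
  have lim: "(\<lambda>n. unit_cdf (N n) t) \<longlonglongrightarrow> unit_cdf M t" for t
  proof (rule LIM_zero_cancel, rule Lim_null_comparison[OF _ LIMSEQ_Suc[OF lim_const_over_n[of 1]]], intro always_eventually allI)
    show "norm (unit_cdf (N n) t - unit_cdf M t) \<le> 1 / Suc n" for n
      using mz(4)[of n t] by (simp add: N_def h_def unit_cdf_orbit_measure[OF mz(2,1)])
  qed
  have "limitin (weak_topology f) N M sequentially"
    unfolding limitin_weak_topology
  proof (intro conjI allI impI)
    fix \<phi> :: "real \<Rightarrow> real" assume "continuous_on {0..1} \<phi>"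
    then show "(\<lambda>n. \<integral>x. \<phi> x \<partial>N n) \<longlonglongrightarrow> (\<integral>x. \<phi> x \<partial>M)"
      using inv Ninv lim by (intro integral_tendsto_of_unit_cdf) (auto simp: invariant_measures_def)
  qed (use inv Ninv in auto)
  with CO show ?thesis by blast
qed

text \<open>Every relatively open neighbourhood of an ergodic measure catches a term of its
  approximating sequence, and \<open>CO_subset_ergodic\<close> keeps that term in the
  subspace.\<close>

theorem corollary10p5:
  fixes f :: "real \<Rightarrow> real"
  assumes "continuous_on {0..1} f" and "f \<in> {0..1} \<rightarrow> {0..1}"
  shows "subtopology (weak_topology f) (ergodic_measures f) closure_of CO_measures f
           = ergodic_measures f \<and>
         (\<forall>M\<in>ergodic_measures f. \<exists>N :: nat \<Rightarrow> real measure.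
            (\<forall>n. N n \<in> CO_measures f) \<and> limitin (weak_topology f) N M sequentially)"
proof -
  interpret interval_map f using assms by unfold_locales
  have top: "topspace (subtopology (weak_topology f) (ergodic_measures f)) = ergodic_measures f"
    by (auto simp: ergodic_measures_def)
  have "M \<in> subtopology (weak_topology f) (ergodic_measures f) closure_of CO_measures f"
    if M: "M \<in> ergodic_measures f" for M
    unfolding in_closure_of
  proof (intro conjI allI impI)
    fix W assume "M \<in> W \<and> openin (subtopology (weak_topology f) (ergodic_measures f)) W"
    then obtain V where V: "openin (weak_topology f) V" "W = V \<inter> ergodic_measures f" "M \<in> V"
      by (auto simp: openin_subtopology)
    obtain N where N: "\<And>n. N n \<in> CO_measures f" "limitin (weak_topology f) N M sequentially"
      using ergodic_limit_of_CO[OF M] by blast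
    have "\<forall>\<^sub>F n in sequentially. N n \<in> V" using limitinD[OF N(2) V(1,3)] .
    then obtain n where "N n \<in> V" by (auto simp: eventually_sequentially)
    then show "\<exists>L. L \<in> CO_measures f \<and> L \<in> W"
      using N(1)[of n] CO_subset_ergodic V(2) by blast
  qed (use M top in simp)
  then show ?thesis
    using ergodic_limit_of_CO closure_of_subset_topspace[of "subtopology (weak_topology f) (ergodic_measures f)"] top
    by blast
qed

end
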